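(* Let $F(z)$ be a monic $p\times p$ matrix polynomial of degree at least $1$ with even part $F_e(z)$ and odd part $F_o(z)$. Assume that $F_e(z)$ is regular when $\deg F$ is odd, and that the rational matrix function $R_F(z)=-F_o(z)F_e(z)^{-1}$, $z\in\mathbb C\setminus\sigma(F_e)$, is self-adjoint. Then $F(z)$ is Hurwitz stable if and only if the following conditions are simultaneously true: (a) $R_F(z)$ is a matrix-valued Herglotz-Nevanlinna function; (b) $F_e(z)$ and $F_o(z)$ are right coprime; (c) all zeros of $F_e(z)$ are negative real; (d) $F_o(z)$ is regular when $\deg F$ is even; (e) $\lim_{z\to\infty}R_F(z)\prec0$ when $\deg F$ is odd. In this case, $F_e(z)$ is simple.
   Context: Here $p\in\mathbb N$; $^*$ is the conjugate transpose; $\prec0$ means self-adjoint and negative definite, $\succeq0$ nonnegative definite. A $p\times p$ matrix polynomial $F(z)=\sum_{k=0}^nA_kz^{n-k}$ with $A_k\in\mathbb C^{p\times p}$, $A_0\ne0_p$, has degree $\deg F=n$; it is monic if $A_0=I_p$, and regular if $\det F\not\equiv0$. A zero of a regular $F$ is a $\lambda\in\mathbb C$ with $\det F(\lambda)=0$ (multiplicity: as a root of $\det F$); $\sigma(F)$ is the set of zeros. A regular $F$ is Hurwitz stable if $\sigma(F)$ lies in the open left half-plane. $F$ is simple if it is regular and, for every zero $\lambda$, the multiplicity of $\lambda$ equals the nullity of $F(\lambda)$. The even part $F_e$ and odd part $F_o$ of $F$ are the matrix polynomials with $F(z)=F_e(z^2)+zF_o(z^2)$. For monic $F$, $F_e$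 is monic if $\deg F$ is even and $F_o$ is monic if $\deg F$ is odd. $G$ is a right divisor of $F$ if $F=CG$ for some matrix polynomial $C$. A right common divisor of $F$ and $\widetilde F$ is a right divisor of both; it is a greatest right common divisor (GRCD) if every other right common divisor is a right divisor of it. $F$ and $\widetilde F$ are right coprime if any GRCD of them is unimodular, i.e. its determinant never vanishes in $\mathbb C$. A rational matrix function $R$ (entries are complex rational functions) is self-adjoint if $R(z)=R(\bar z)^*$ for all $z\in\mathbb C$ except the poles of its entries. $R$ is a matrix-valued Herglotz-Nevanlinna function if it is holomorphic on the open upper half-plane $\mathbb C_+$ and $\frac1{2\mathrm i}(R(z)-R(z)^* )\succeq0$ for all $z\in\mathbb C_+$. *)

theory Defs
  imports
    "HOL-Analysis.Analysis"
    "HOL-Computational_Algebra.Field_as_Ring"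
    "HOL-Computational_Algebra.Polynomial_Factorial"
begin

section \<open>Complex matrices\<close>

definition ctranspose :: "complex ^ 'p::finite ^ 'p \<Rightarrow> complex ^ 'p ^ 'p" where
  "ctranspose A = (\<chi> i j. cnj (A $ j $ i))"

definition self_adjoint_matrix :: "complex ^ 'p::finite ^ 'p \<Rightarrow> bool" where
  "self_adjoint_matrix A \<longleftrightarrow> ctranspose A = A"

text \<open>The scalar $x^* A x$; it is real for self-adjoint $A$, so that only its real part enters
  the definiteness notions below.\<close>

definition quad_form :: "complex ^ 'p::finite ^ 'p \<Rightarrow> complex ^ 'p \<Rightarrow> complex" where
  "quad_form A x = (\<Sum>i\<in>UNIV. cnj (x $ i) * (A *v x) $ i)"

definition nonneg_definite :: "complex ^ 'p::finite ^ 'p \<Rightarrow> bool" where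
  "nonneg_definite A \<longleftrightarrow> self_adjoint_matrix A \<and> (\<forall>x. 0 \<le> Re (quad_form A x))"

definition neg_definite :: "complex ^ 'p::finite ^ 'p \<Rightarrow> bool" where
  "neg_definite A \<longleftrightarrow> self_adjoint_matrix A \<and> (\<forall>x. x \<noteq> 0 \<longrightarrow> Re (quad_form A x) < 0)"

definition nullity :: "complex ^ 'p::finite ^ 'p \<Rightarrow> nat" where
  "nullity A = vec.dim {x. A *v x = 0}"


section \<open>Matrix polynomials\<close>

text \<open>A matrix polynomial is a matrix with polynomial entries. (Polynomials with coefficients in
  \<^typ>\<open>complex ^ 'p ^ 'p\<close> would not do: the type class multiplication there is entrywise.)\<close>

type_synonym 'p matpoly = "complex poly ^ 'p ^ 'p"

definition mp_eval :: "'p::finite matpoly \<Rightarrow> complex \<Rightarrow> complex ^ 'p ^ 'p" where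
  "mp_eval F z = map_matrix (\<lambda>q. poly q z) F"

definition mp_coeff :: "'p::finite matpoly \<Rightarrow> nat \<Rightarrow> complex ^ 'p ^ 'p" where
  "mp_coeff F k = map_matrix (\<lambda>q. coeff q k) F"

definition mp_degree :: "'p::finite matpoly \<Rightarrow> nat" where
  "mp_degree F = (LEAST n. \<forall>k>n. mp_coeff F k = 0)"

definition mp_monic :: "'p::finite matpoly \<Rightarrow> bool" where
  "mp_monic F \<longleftrightarrow> mp_coeff F (mp_degree F) = mat 1"

definition mp_regular :: "'p::finite matpoly \<Rightarrow> bool" where
  "mp_regular F \<longleftrightarrow> det F \<noteq> 0"

definition mp_zeros :: "'p::finite matpoly \<Rightarrow> complex set" where
  "mp_zeros F = {z. det (mp_eval F z) = 0}"

definition hurwitz_stable :: "'p::finite matpoly \<Rightarrow> bool" where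
  "hurwitz_stable F \<longleftrightarrow> mp_regular F \<and> (\<forall>z\<in>mp_zeros F. Re z < 0)"

definition mp_simple :: "'p::finite matpoly \<Rightarrow> bool" where
  "mp_simple F \<longleftrightarrow> mp_regular F \<and> (\<forall>z\<in>mp_zeros F. order z (det F) = nullity (mp_eval F z))"

text \<open>$F(z) = F_e(z^2) + z F_o(z^2)$, written out entrywise.\<close>

definition even_odd_parts :: "'p::finite matpoly \<Rightarrow> 'p matpoly \<Rightarrow> 'p matpoly \<Rightarrow> bool" where
  "even_odd_parts F Fe Fo \<longleftrightarrow>
     (\<forall>z i j. mp_eval F z $ i $ j = mp_eval Fe (z\<^sup>2) $ i $ j + z * mp_eval Fo (z\<^sup>2) $ i $ j)"

text \<open>The even and the odd part exist and are uniquely determined.\<close>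

lemma even_odd_parts_poly: "\<exists>e h. \<forall>z::complex. poly q z = poly e (z\<^sup>2) + z * poly h (z\<^sup>2)"
proof (induction q)
  case 0
  have "\<forall>z::complex. poly 0 z = poly 0 (z\<^sup>2) + z * poly 0 (z\<^sup>2)"
    by simp
  then show ?case by blast
next
  case (pCons a q)
  then obtain e h where "\<And>z::complex. poly q z = poly e (z\<^sup>2) + z * poly h (z\<^sup>2)"
    by blast
  then have "\<forall>z. poly (pCons a q) z = poly (pCons a h) (z\<^sup>2) + z * poly e (z\<^sup>2)"
    by (simp add: algebra_simps power2_eq_square)
  then show ?case by blast
qed

lemma even_odd_parts_exist: "\<exists>Fe Fo. even_odd_parts F Fe Fo"
proof -
  obtain e where "\<And>q. \<exists>h. \<forall>z::complex. poly q z = poly (e q) (z\<^sup>2) + z * poly h (z\<^sup>2)"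
    using even_odd_parts_poly by metis
  then obtain h where eh: "\<And>q z. poly q z = poly (e q) (z\<^sup>2) + z * poly (h q) (z\<^sup>2)"
    by metis
  have "even_odd_parts F (map_matrix e F) (map_matrix h F)"
    unfolding even_odd_parts_def mp_eval_def nth_map_matrix using eh by blast
  then show ?thesis by blast
qed

lemma even_odd_parts_unique:
  assumes "even_odd_parts F Fe Fo" "even_odd_parts F Fe' Fo'"
  shows "Fe = Fe' \<and> Fo = Fo'"
proof -
  have "Fe $ i $ j = Fe' $ i $ j \<and> Fo $ i $ j = Fo' $ i $ j" for i j
  proof -
    define d where "d = Fe $ i $ j - Fe' $ i $ j"
    define c where "c = Fo $ i $ j - Fo' $ i $ j"
    have eq: "poly d (z\<^sup>2) + z * poly c (z\<^sup>2) = 0" for z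
    proof -
      have "poly (Fe $ i $ j) (z\<^sup>2) + z * poly (Fo $ i $ j) (z\<^sup>2)
          = poly (Fe' $ i $ j) (z\<^sup>2) + z * poly (Fo' $ i $ j) (z\<^sup>2)"
        using assms unfolding even_odd_parts_def mp_eval_def nth_map_matrix by metis
      then show ?thesis by (simp add: d_def c_def algebra_simps)
    qed
    have d0: "poly d w = 0" for w
      using eq[of "csqrt w"] eq[of "- csqrt w"] by simp
    have c0: "poly (pCons 0 c) w = 0" for w
      using eq[of "csqrt w"] d0 by auto
    have "d = 0" using d0 poly_all_0_iff_0 by blast
    moreover have "pCons 0 c = 0" using c0 poly_all_0_iff_0 by blast
    ultimately show ?thesis by (simp add: d_def c_def)
  qed
  then show ?thesis by (simp add: vec_eq_iff)
qed

definition right_divisor :: "'p::finite matpoly \<Rightarrow> 'p matpoly \<Rightarrow> bool" where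
  "right_divisor G F \<longleftrightarrow> (\<exists>C. F = C ** G)"

definition right_common_divisor :: "'p::finite matpoly \<Rightarrow> 'p matpoly \<Rightarrow> 'p matpoly \<Rightarrow> bool" where
  "right_common_divisor G F F' \<longleftrightarrow> right_divisor G F \<and> right_divisor G F'"

definition is_grcd :: "'p::finite matpoly \<Rightarrow> 'p matpoly \<Rightarrow> 'p matpoly \<Rightarrow> bool" where
  "is_grcd G F F' \<longleftrightarrow> right_common_divisor G F F' \<and>
     (\<forall>H. right_common_divisor H F F' \<longrightarrow> right_divisor H G)"

definition unimodular :: "'p::finite matpoly \<Rightarrow> bool" where
  "unimodular G \<longleftrightarrow> (\<forall>z. det (mp_eval G z) \<noteq> 0)"

definition right_coprime :: "'p::finite matpoly \<Rightarrow> 'p matpoly \<Rightarrow> bool" where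
  "right_coprime F F' \<longleftrightarrow> (\<forall>G. is_grcd G F F' \<longrightarrow> unimodular G)"


section \<open>Rational matrix functions\<close>

text \<open>A rational function is an element of the field of fractions of the polynomials. It is
  evaluated in lowest terms, so removable singularities are removed; at its poles
  \<open>rat_eval\<close> takes the meaningless value \<open>0\<close>.\<close>

type_synonym 'p ratmat = "complex poly fract ^ 'p ^ 'p"

definition rat_poles :: "complex poly fract \<Rightarrow> complex set" where
  "rat_poles r = {z. poly (snd (quot_of_fract r)) z = 0}"

definition rat_eval :: "complex poly fract \<Rightarrow> complex \<Rightarrow> complex" where
  "rat_eval r z = poly (fst (quot_of_fract r)) z / poly (snd (quot_of_fract r)) z"

definition rm_poles :: "'p::finite ratmat \<Rightarrow> complex set" where
  "rm_poles R = (\<Union>i j. rat_poles (R $ i $ j))"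

definition rm_eval :: "'p::finite ratmat \<Rightarrow> complex \<Rightarrow> complex ^ 'p ^ 'p" where
  "rm_eval R z = map_matrix (\<lambda>r. rat_eval r z) R"

text \<open>If \<open>cnj z\<close> is a pole but \<open>z\<close> is not, the equation below is about a meaningless value.
  This does no harm: the equations near \<open>z\<close> already force the poles to be symmetric with respect
  to the real axis.\<close>

definition self_adjoint_rm :: "'p::finite ratmat \<Rightarrow> bool" where
  "self_adjoint_rm R \<longleftrightarrow>
     (\<forall>z. z \<notin> rm_poles R \<longrightarrow> rm_eval R z = ctranspose (rm_eval R (cnj z)))"

text \<open>Holomorphy excludes poles in the upper half-plane, since the function
  \<open>rat_eval r\<close> is discontinuous at each pole of \<open>r\<close>.\<close>

definition herglotz_nevanlinna :: "'p::finite ratmat \<Rightarrow> bool" where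
  "herglotz_nevanlinna R \<longleftrightarrow>
     (\<forall>i j. (\<lambda>z. rm_eval R z $ i $ j) holomorphic_on {z. Im z > 0}) \<and>
     (\<forall>z. Im z > 0 \<longrightarrow>
        nonneg_definite
          (map_matrix (\<lambda>c. c / (2 * \<i>)) (rm_eval R z - ctranspose (rm_eval R z))))"

definition assoc_rational :: "'p::finite matpoly \<Rightarrow> 'p matpoly \<Rightarrow> 'p ratmat" where
  "assoc_rational Fe Fo =
     - (map_matrix to_fract Fo ** matrix_inv (map_matrix to_fract Fe))"

end

theory Submission
  imports Defs "HOL-Complex_Analysis.Complex_Analysis"
    "HOL-Computational_Algebra.Fundamental_Theorem_Algebra"
begin

no_notation fps_nth (infixl "$" 75)

text \<open>Self-adjointness of \<open>R = - F\<^sub>o F\<^sub>e\<^sup>-\<^sup>1\<close> means that \<open>F\<^sub>e(w)\<^sup>* F\<^sub>o(w)\<close> is Hermitian for real \<open>w\<close>, hence that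
  \<open>|F(-z) x| = |F(z) x|\<close> on the imaginary axis. If \<open>F\<close> is stable, then \<open>\<Theta>(z) = F(-z) F(z)\<^sup>-\<^sup>1\<close> is holomorphic
  and, by the maximum modulus principle, contractive in the right half-plane. Thus for every vector \<open>v\<close>
  the scalar functions \<open>\<langle>v, (I \<plusminus> \<Theta>) v\<rangle>\<close> have nonnegative real part there, and Harnack's inequality shows that
  they vanish identically as soon as they vanish at an interior point, or to second order at a boundary
  point or at infinity. Applied at an interior point this puts the zeros of \<open>F\<^sub>e\<close> on the negative axis;
  at a boundary point it excludes Jordan chains of \<open>F\<^sub>e\<close>, so that \<open>F\<^sub>e\<close> is simple; at infinity it
  shows that the second coefficient of \<open>F\<close> is positive definite, which governs \<open>F\<^sub>o\<close> and the limit of \<open>R\<close>.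
  The Herglotz-Nevanlinna property comes from the Schwarz-Pick lemma for \<open>s \<mapsto> - s \<langle>y, R(s\<^sup>2) y\<rangle>\<close>, a
  self-map of the right half-plane that is real on the positive axis and therefore satisfies
  \<open>|arg f(s)| \<le> |arg s|\<close>.

  Conversely, \<open>F(z) x = 0\<close> with \<open>Re z \<ge> 0\<close> gives \<open>R(z\<^sup>2) y = y / z\<close> for \<open>y = F\<^sub>e(z\<^sup>2) x\<close>, which
  contradicts the sign of the imaginary part of \<open>R\<close>, or its monotonicity on the positive axis, or coprimeness.\<close>

section \<open>Holomorphic functions on the right half-plane\<close>

lemma cmod_add_cnj_diff:
  "(cmod (a + cnj b))\<^sup>2 - (cmod (a - b))\<^sup>2 = 4 * Re a * Re b"
  unfolding cmod_power2 by (simp add: power2_eq_square algebra_simps)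

text \<open>\<open>- cnj b\<close> is the mirror image of \<open>b\<close> in the imaginary axis, so
  the Cayley quotient \<open>(a - b) / (a + cnj b)\<close> has modulus below 1.\<close>

lemma cmod_diff_less_add_cnj:
  assumes "Re a > 0" "Re b > 0"
  shows "cmod (a - b) < cmod (a + cnj b)"
proof -
  have "4 * Re a * Re b > 0" using assms by simp
  then have "(cmod (a - b))\<^sup>2 < (cmod (a + cnj b))\<^sup>2"
    using cmod_add_cnj_diff[of a b] by linarith
  then show ?thesis by (rule power2_less_imp_less) simp
qed

text \<open>Schwarz's lemma carried over by Cayley maps: \<open>\<phi>\<close> sends the unit disc
  into the half-plane with \<open>0\<close> going to \<open>r\<close>, and \<open>g\<close> returns
  to the disc with \<open>f r\<close> going to \<open>0\<close>. The conclusion is free of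
  quotients, so that it survives the passage to functions whose real part may vanish.\<close>

lemma Schwarz_Pick_half_plane_strict:
  assumes holf: "f holomorphic_on {z. Re z > 0}"
    and pos: "\<And>z. Re z > 0 \<Longrightarrow> Re (f z) > 0"
    and r: "Re r > 0" and s: "Re s > 0"
  shows "cmod (f s - f r) * cmod (s + cnj r) \<le> cmod (f s + cnj (f r)) * cmod (s - r)"
proof -
  define \<phi> where "\<phi> = (\<lambda>\<zeta>. (r + cnj r * \<zeta>) / (1 - \<zeta>))"
  define g where "g = (\<lambda>\<zeta>. (f (\<phi> \<zeta>) - f r) / (f (\<phi> \<zeta>) + cnj (f r)))"
  have re\<phi>: "Re (\<phi> \<zeta>) > 0" if "cmod \<zeta> < 1" for \<zeta>
  proof -
    have ne: "1 - \<zeta> \<noteq> 0" using that by auto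
    have "Re (\<phi> \<zeta>) = Re ((r + cnj r * \<zeta>) * cnj (1 - \<zeta>)) / (cmod (1 - \<zeta>))\<^sup>2"
      unfolding \<phi>_def by (subst complex_div_cnj) (simp only: Re_divide_of_real flip: of_real_power)
    also have "Re ((r + cnj r * \<zeta>) * cnj (1 - \<zeta>)) = Re r * (1 - (cmod \<zeta>)\<^sup>2)"
      unfolding cmod_power2 by (simp add: power2_eq_square algebra_simps)
    finally have eq: "Re (\<phi> \<zeta>) = Re r * (1 - (cmod \<zeta>)\<^sup>2) / (cmod (1 - \<zeta>))\<^sup>2" .
    have "(cmod \<zeta>)\<^sup>2 < 1" using that by (simp add: abs_square_less_1)
    then show ?thesis unfolding eq using r ne by simp
  qed
  have nz: "f (\<phi> \<zeta>) + cnj (f r) \<noteq> 0" if "cmod \<zeta> < 1" for \<zeta>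
  proof
    assume "f (\<phi> \<zeta>) + cnj (f r) = 0"
    then have "Re (f (\<phi> \<zeta>)) + Re (f r) = 0" by (metis complex_cnj plus_complex.sel(1) zero_complex.sel(1) cnj.sel(1))
    then show False using pos[OF re\<phi>[OF that]] pos[OF r] by linarith
  qed
  have hol\<phi>: "\<phi> holomorphic_on ball 0 1"
    unfolding \<phi>_def by (intro holomorphic_intros) auto
  have "f \<circ> \<phi> holomorphic_on ball 0 1"
    by (rule holomorphic_on_compose_gen[OF hol\<phi> holf]) (auto simp: re\<phi>)
  then have holg: "g holomorphic_on ball 0 1"
    unfolding g_def comp_def by (intro holomorphic_intros) (auto simp: nz)
  have g0: "g 0 = 0" by (simp add: g_def \<phi>_def)
  have gl: "cmod (g \<zeta>) < 1" if "cmod \<zeta> < 1" for \<zeta>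
    using cmod_diff_less_add_cnj[OF pos[OF re\<phi>[OF that]] pos[OF r]] nz[OF that]
    by (simp add: g_def norm_divide)
  define \<xi> where "\<xi> = (s - r) / (s + cnj r)"
  have D: "cmod (s - r) < cmod (s + cnj r)" using cmod_diff_less_add_cnj[OF s r] .
  then have Dp: "cmod (s + cnj r) > 0" by (smt (verit) norm_ge_zero)
  then have Dne: "s + cnj r \<noteq> 0" by auto
  have \<xi>1: "cmod \<xi> < 1" using D Dp by (simp add: \<xi>_def norm_divide)
  have rr: "r + cnj r \<noteq> 0" using r by (simp add: complex_eq_iff)
  have "1 - \<xi> = (r + cnj r) / (s + cnj r)"
    unfolding \<xi>_def using Dne by (simp add: field_simps)
  moreover have "r + cnj r * \<xi> = s * (r + cnj r) / (s + cnj r)"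
    unfolding \<xi>_def using Dne by (simp add: field_simps)
  ultimately have \<phi>\<xi>: "\<phi> \<xi> = s"
    unfolding \<phi>_def using Dne rr by simp
  have "cmod (g \<xi>) \<le> cmod \<xi>" by (rule Schwarz_Lemma(1)[OF holg g0 gl \<xi>1])
  then have "cmod (f s - f r) / cmod (f s + cnj (f r)) \<le> cmod (s - r) / cmod (s + cnj r)"
    unfolding g_def \<phi>\<xi> by (simp add: \<xi>_def norm_divide)
  moreover have "cmod (f s + cnj (f r)) > 0" using nz[OF \<xi>1] \<phi>\<xi> by simp
  ultimately show ?thesis using Dp by (simp add: field_simps)
qed

text \<open>The strict version applies to \<open>f + e\<close> for every \<open>e > 0\<close>; then
  \<open>e\<close> tends to 0 from the right.\<close>

lemma Schwarz_Pick_half_plane: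
  assumes holf: "f holomorphic_on {z. Re z > 0}"
    and pos: "\<And>z. Re z > 0 \<Longrightarrow> Re (f z) \<ge> 0"
    and r: "Re r > 0" and s: "Re s > 0"
  shows "cmod (f s - f r) * cmod (s + cnj r) \<le> cmod (f s + cnj (f r)) * cmod (s - r)"
proof (rule tendsto_le[OF trivial_limit_at_right_real])
  show "((\<lambda>e. cmod (f s - f r) * cmod (s + cnj r)) \<longlongrightarrow> cmod (f s - f r) * cmod (s + cnj r)) (at_right 0)"
    by (rule tendsto_const)
  show "((\<lambda>e. cmod (f s + cnj (f r) + of_real (2 * e)) * cmod (s - r))
      \<longlongrightarrow> cmod (f s + cnj (f r)) * cmod (s - r)) (at_right 0)"
    by (rule tendsto_eq_intros refl tendsto_norm)+ (simp_all)
  show "\<forall>\<^sub>F e in at_right 0. cmod (f s - f r) * cmod (s + cnj r)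
      \<le> cmod (f s + cnj (f r) + of_real (2 * e)) * cmod (s - r)"
  proof (rule eventually_at_right_less[THEN eventually_mono])
    fix e :: real assume e: "0 < e"
    have "cmod ((f s + of_real e) - (f r + of_real e)) * cmod (s + cnj r)
        \<le> cmod ((f s + of_real e) + cnj (f r + of_real e)) * cmod (s - r)"
    proof (rule Schwarz_Pick_half_plane_strict[OF _ _ r s, of "\<lambda>z. f z + of_real e"])
      show "(\<lambda>z. f z + of_real e) holomorphic_on {z. 0 < Re z}"
        by (intro holomorphic_intros holf)
      show "0 < Re (f z + complex_of_real e)" if "0 < Re z" for z
        using pos[OF that] e by simp
    qed
    then show "cmod (f s - f r) * cmod (s + cnj r)
      \<le> cmod (f s + cnj (f r) + of_real (2 * e)) * cmod (s - r)"
      by (simp add: algebra_simps)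
  qed
qed

text \<open>The triangle inequality turns Schwarz-Pick into
  \<open>|f r| (D - d) <= |f s| (D + d)\<close>, and \<open>D\<^sup>2 - d\<^sup>2\<close> is known
  explicitly. Read as a lower bound for \<open>f s\<close>, it shows how slowly \<open>f\<close>
  must decay towards the boundary or infinity unless \<open>f r = 0\<close>.\<close>

lemma Harnack_half_plane:
  assumes holf: "f holomorphic_on {z. Re z > 0}"
    and pos: "\<And>z. Re z > 0 \<Longrightarrow> Re (f z) \<ge> 0"
    and r: "Re r > 0" and s: "Re s > 0"
  shows "Re s * Re r * cmod (f r) \<le> (cmod (s + cnj r))\<^sup>2 * cmod (f s)"
proof -
  define D where "D = cmod (s + cnj r)"
  define d where "d = cmod (s - r)"
  have d: "0 \<le> d" "d < D" using cmod_diff_less_add_cnj[OF s r] by (simp_all add: D_def d_def)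
  have "cmod (f r) - cmod (f s) \<le> cmod (f s - f r)"
    by (metis norm_minus_commute norm_triangle_ineq2)
  then have "(cmod (f r) - cmod (f s)) * D \<le> cmod (f s - f r) * D"
    using d by (intro mult_right_mono) auto
  also have "\<dots> \<le> cmod (f s + cnj (f r)) * d"
    unfolding D_def d_def by (rule Schwarz_Pick_half_plane[OF assms])
  also have "\<dots> \<le> (cmod (f s) + cmod (f r)) * d"
    using d norm_triangle_ineq[of "f s" "cnj (f r)"] by (intro mult_right_mono) auto
  finally have "cmod (f r) * (D - d) \<le> cmod (f s) * (D + d)" by (simp add: algebra_simps)
  then have "cmod (f r) * (D - d) * (D + d) \<le> cmod (f s) * (D + d) * (D + d)"
    using d by (intro mult_right_mono) auto
  also have "\<dots> \<le> cmod (f s) * (2 * D) * (2 * D)"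
    using d by (intro mult_mono) auto
  finally have "cmod (f r) * (D\<^sup>2 - d\<^sup>2) \<le> 4 * (D\<^sup>2 * cmod (f s))"
    by (simp add: algebra_simps power2_eq_square)
  moreover have "D\<^sup>2 - d\<^sup>2 = 4 * Re s * Re r"
    unfolding D_def d_def by (rule cmod_add_cnj_diff)
  ultimately show ?thesis unfolding D_def by (simp add: algebra_simps)
qed

text \<open>This is \<open>|arg f(s)| <= |arg s|\<close> with denominators cleared. Schwarz-Pick is
  applied to \<open>s\<close> and the point \<open>\<rho> = |s|\<close> of the positive axis, where
  \<open>f\<close> takes a real value \<open>b\<close>.\<close>

lemma Stolz_angle_half_plane:
  assumes holf: "f holomorphic_on {z. Re z > 0}"
    and pos: "\<And>z. Re z > 0 \<Longrightarrow> Re (f z) \<ge> 0"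
    and real: "\<And>x. x > 0 \<Longrightarrow> Im (f (of_real x)) = 0"
    and s: "Re s > 0"
  shows "\<bar>Im (f s)\<bar> * Re s \<le> Re (f s) * \<bar>Im s\<bar>"
proof -
  define \<rho> where "\<rho> = cmod s"
  define b where "b = Re (f (of_real \<rho>))"
  define u where "u = Re (f s)"
  define v where "v = Im (f s)"
  define \<sigma> where "\<sigma> = Re s"
  have \<rho>: "\<rho> > 0" using s by (auto simp: \<rho>_def)
  have b: "b \<ge> 0" "f (of_real \<rho>) = of_real b"
    using pos[of "of_real \<rho>"] real[OF \<rho>] \<rho> by (auto simp: b_def complex_eq_iff)
  have "cmod (f s - of_real b) * cmod (s + of_real \<rho>) \<le> cmod (f s + of_real b) * cmod (s - of_real \<rho>)"
    using Schwarz_Pick_half_plane[OF holf pos, of "of_real \<rho>" s] \<rho> s b by simp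
  then have "(cmod (f s - of_real b) * cmod (s + of_real \<rho>))\<^sup>2 \<le> (cmod (f s + of_real b) * cmod (s - of_real \<rho>))\<^sup>2"
    by (intro power_mono) auto
  moreover have "(cmod (s + of_real \<rho>))\<^sup>2 = 2 * \<rho> * (\<rho> + \<sigma>)" "(cmod (s - of_real \<rho>))\<^sup>2 = 2 * \<rho> * (\<rho> - \<sigma>)"
  proof -
    have "\<rho>\<^sup>2 = \<sigma>\<^sup>2 + (Im s)\<^sup>2" unfolding \<rho>_def \<sigma>_def by (rule cmod_power2)
    then show "(cmod (s + of_real \<rho>))\<^sup>2 = 2 * \<rho> * (\<rho> + \<sigma>)" "(cmod (s - of_real \<rho>))\<^sup>2 = 2 * \<rho> * (\<rho> - \<sigma>)"
      unfolding cmod_power2 by (simp_all add: \<sigma>_def power2_eq_square algebra_simps)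
  qed
  ultimately have "(cmod (f s - of_real b))\<^sup>2 * (2 * \<rho> * (\<rho> + \<sigma>)) \<le> (cmod (f s + of_real b))\<^sup>2 * (2 * \<rho> * (\<rho> - \<sigma>))"
    unfolding power_mult_distrib by simp
  then have "2 * \<rho> * ((cmod (f s - of_real b))\<^sup>2 * (\<rho> + \<sigma>)) \<le> 2 * \<rho> * ((cmod (f s + of_real b))\<^sup>2 * (\<rho> - \<sigma>))"
    by (simp add: algebra_simps)
  then have "(cmod (f s - of_real b))\<^sup>2 * (\<rho> + \<sigma>) \<le> (cmod (f s + of_real b))\<^sup>2 * (\<rho> - \<sigma>)"
    using \<rho> by simp
  then have 1: "(u\<^sup>2 + v\<^sup>2 + b\<^sup>2) * \<sigma> \<le> 2 * b * u * \<rho>"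
    unfolding cmod_power2 by (simp add: u_def v_def power2_eq_square algebra_simps)
  have \<sigma>: "\<sigma> > 0" "u \<ge> 0" using s pos by (auto simp: \<sigma>_def u_def)
  define c where "c = cmod (f s)"
  have c: "c\<^sup>2 = u\<^sup>2 + v\<^sup>2" "c \<ge> 0" unfolding c_def u_def v_def by (simp_all add: cmod_power2)
  \<comment> \<open>Up to denominators this is \<open>cos (arg s) <= cos (arg (f s))\<close>; for
    \<open>b > 0\<close> the unknown value \<open>b\<close> is eliminated by
    \<open>2 b c <= c^2 + b^2\<close>.\<close>
  have 2: "c * \<sigma> \<le> u * \<rho>"
  proof (cases "b = 0")
    case True
    have "c\<^sup>2 * \<sigma> \<le> 0" using 1 True c by simp
    then have "c = 0" using \<sigma> by (simp add: mult_le_0_iff)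
    then show ?thesis using \<sigma> \<rho> by simp
  next
    case False
    have "2 * b * c \<le> c\<^sup>2 + b\<^sup>2" using sum_squares_bound[of b c] by (simp add: algebra_simps)
    then have "2 * b * c * \<sigma> \<le> (c\<^sup>2 + b\<^sup>2) * \<sigma>" using \<sigma> by (intro mult_right_mono) auto
    also have "\<dots> \<le> 2 * b * u * \<rho>" using 1 c by (simp add: algebra_simps)
    finally have "(2 * b) * (c * \<sigma>) \<le> (2 * b) * (u * \<rho>)" by (simp add: algebra_simps)
    then show ?thesis using b False by simp
  qed
  then have "(c * \<sigma>)\<^sup>2 \<le> (u * \<rho>)\<^sup>2" using c \<sigma> by (intro power_mono) auto
  then have "(u\<^sup>2 + v\<^sup>2) * \<sigma>\<^sup>2 \<le> u\<^sup>2 * (\<sigma>\<^sup>2 + (Im s)\<^sup>2)"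
    unfolding power_mult_distrib c \<rho>_def cmod_power2 \<sigma>_def .
  then have "(\<bar>v\<bar> * \<sigma>)\<^sup>2 \<le> (u * \<bar>Im s\<bar>)\<^sup>2" by (simp add: power_mult_distrib algebra_simps)
  then show ?thesis unfolding u_def v_def \<sigma>_def
    by (rule power2_le_imp_le) (use pos[OF s] in auto)
qed

text \<open>The frontier of a large half-disc consists of a segment of the imaginary axis, where
  \<open>bd\<close> applies, and an arc, where \<open>inf\<close> gives the bound up to
  \<open>e\<close>.\<close>

lemma maximum_modulus_half_plane:
  assumes holg: "g holomorphic_on {z. Re z > 0}"
    and contg: "continuous_on {z. Re z \<ge> 0} g"
    and bd: "\<And>z. Re z = 0 \<Longrightarrow> cmod (g z) \<le> B"
    and inf: "\<And>e. e > 0 \<Longrightarrow> \<exists>\<rho>. \<forall>z. Re z \<ge> 0 \<longrightarrow> cmod z \<ge> \<rho> \<longrightarrow> cmod (g z) \<le> B + e"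
    and z: "Re z \<ge> 0"
  shows "cmod (g z) \<le> B"
proof (rule field_le_epsilon)
  fix e :: real assume e: "e > 0"
  obtain \<rho>0 where \<rho>0: "\<And>z. Re z \<ge> 0 \<Longrightarrow> cmod z \<ge> \<rho>0 \<Longrightarrow> cmod (g z) \<le> B + e"
    using inf[OF e] by blast
  define \<rho> where "\<rho> = max \<rho>0 (cmod z + 1)"
  define S where "S = {z. Re z \<ge> 0} \<inter> cball 0 \<rho>"
  have cl: "closed S" unfolding S_def by (intro closed_Int closed_halfspace_Re_ge closed_cball)
  have int: "interior S = {z. Re z > 0} \<inter> ball 0 \<rho>"
    unfolding S_def interior_Int interior_cball
    using interior_halfspace_ge[of "1::complex" 0] by (simp add: inner_complex_def)
  show "cmod (g z) \<le> B + e"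
  proof (rule maximum_modulus_frontier[of g S])
    show "g holomorphic_on interior S" unfolding int by (rule holomorphic_on_subset[OF holg]) auto
    show "continuous_on (closure S) g" unfolding closure_closed[OF cl]
      by (rule continuous_on_subset[OF contg]) (auto simp: S_def)
    show "bounded S" unfolding S_def by (intro bounded_Int disjI2 bounded_cball)
    show "z \<in> S" using z by (auto simp: S_def \<rho>_def)
    show "cmod (g w) \<le> B + e" if "w \<in> frontier S" for w
    proof -
      have w: "w \<in> S" "w \<notin> interior S" using that cl by (auto simp: frontier_def)
      then have "Re w = 0 \<or> cmod w = \<rho>" unfolding int by (auto simp: S_def)
      then show ?thesis
      proof
        assume "Re w = 0" then show ?thesis using bd[of w] e by simp
      next
        assume "cmod w = \<rho>" then show ?thesis using w by (intro \<rho>0) (auto simp: S_def \<rho>_def)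
      qed
    qed
  qed
qed

text \<open>The imaginary part is nonnegative above the real axis and vanishes on it, so that
  the derivative along the real axis is nonnegative.\<close>

lemma real_part_mono_on_axis:
  fixes G :: "complex \<Rightarrow> complex"
  assumes holG: "G holomorphic_on S" "open S" and ray: "\<And>t. 0 < t \<Longrightarrow> of_real t \<in> S"
    and real: "\<And>t. 0 < t \<Longrightarrow> Im (G (of_real t)) = 0"
    and upper: "\<And>z. Im z > 0 \<Longrightarrow> Im (G z) \<ge> 0"
    and st: "0 < s" "s \<le> t"
  shows "Re (G (of_real s)) \<le> Re (G (of_real t))"
proof (rule DERIV_nonneg_imp_nondecreasing[OF st(2)])
  fix r assume "s \<le> r" "r \<le> t"
  then have r: "0 < r" using st by simp
  define D where "D = deriv G (of_real r)"
  have D: "(G has_field_derivative D) (at (of_real r))"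
    unfolding D_def by (rule holomorphic_derivI[OF holG ray[OF r]])
  then have 1: "((\<lambda>t. Re (G (of_real t))) has_real_derivative Re D) (at r)"
    using has_vector_derivative_real_field[OF D]
    by (auto simp: has_real_derivative_iff_has_vector_derivative has_vector_derivative_complex_iff)
  \<comment> \<open>The derivative is computed along \<open>\<i> * e\<close> with \<open>e\<close>
    decreasing to 0: dividing by \<open>\<i> * e\<close> turns the imaginary part of
    \<open>G\<close> into the real part of the difference quotient.\<close>
  have "0 \<le> Re D"
  proof (rule tendsto_lowerbound[OF _ _ trivial_limit_at_right_real])
    have "((\<lambda>h. (G (of_real r + h) - G (of_real r)) / h) \<longlongrightarrow> D) (at 0)"
      using D by (simp add: has_field_derivative_def has_derivative_at DERIV_def flip: DERIV_def)
    moreover have "filterlim (\<lambda>e. \<i> * of_real e) (at 0) (at_right (0::real))"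
      unfolding filterlim_at by (auto intro!: tendsto_eq_intros simp: eventually_at_filter)
    ultimately have "((\<lambda>e. (G (of_real r + \<i> * of_real e) - G (of_real r)) / (\<i> * of_real e)) \<longlongrightarrow> D) (at_right 0)"
      by (rule filterlim_compose)
    then show "((\<lambda>e. Re ((G (of_real r + \<i> * of_real e) - G (of_real r)) / (\<i> * of_real e))) \<longlongrightarrow> Re D) (at_right 0)"
      by (rule tendsto_Re)
    show "\<forall>\<^sub>F e in at_right 0. 0 \<le> Re ((G (of_real r + \<i> * of_real e) - G (of_real r)) / (\<i> * of_real e))"
      using eventually_at_right_less
    proof eventually_elim
      case (elim e)
      have "0 \<le> Im (G (of_real r + \<i> * of_real e))" using elim by (intro upper) simp
      then show ?case using elim real[OF r]
        by (simp add: Re_divide zero_le_divide_iff power2_eq_square)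
    qed
  qed
  with 1 show "\<exists>y. ((\<lambda>t. Re (G (of_real t))) has_real_derivative y) (at r) \<and> 0 \<le> y" by blast
qed

section \<open>Matrices and rational matrix functions\<close>

definition cinner :: "complex ^ 'n \<Rightarrow> complex ^ 'n \<Rightarrow> complex" where
  "cinner x y = (\<Sum>i\<in>UNIV. cnj (x $ i) * y $ i)"

lemma cinner_add: "cinner x (y + z) = cinner x y + cinner x z" "cinner (x + y) z = cinner x z + cinner y z"
  by (simp_all add: cinner_def algebra_simps sum.distrib)

lemma cinner_diff: "cinner x (y - z) = cinner x y - cinner x z" "cinner (x - y) z = cinner x z - cinner y z"
  by (simp_all add: cinner_def algebra_simps sum_subtractf)

lemma cinner_scale: "cinner x (c *s y) = c * cinner x y" "cinner (c *s x) y = cnj c * cinner x y"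
  by (simp_all add: cinner_def algebra_simps sum_distrib_left)

lemma cinner_0 [simp]: "cinner x 0 = 0" "cinner 0 x = 0"
  by (simp_all add: cinner_def)

lemma cinner_minus: "cinner x (- y) = - cinner x y" "cinner (- x) y = - cinner x y"
  by (simp_all add: cinner_def sum_negf)

lemma cnj_cinner: "cnj (cinner x y) = cinner y x"
  by (simp add: cinner_def mult.commute)

lemma cinner_self: "cinner x x = of_real ((norm x)\<^sup>2)"
proof -
  have "(norm x)\<^sup>2 = (\<Sum>i\<in>UNIV. (cmod (x $ i))\<^sup>2)"
    by (simp add: norm_vec_def L2_set_def sum_nonneg)
  then show ?thesis
    by (simp add: cinner_def complex_norm_square mult.commute del: of_real_power)
qed

lemma cmod_cinner_le: "cmod (cinner x y) \<le> norm x * norm y"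
proof -
  have "cmod (cinner x y) \<le> (\<Sum>i\<in>UNIV. \<bar>cmod (x $ i)\<bar> * \<bar>cmod (y $ i)\<bar>)"
    unfolding cinner_def by (rule order_trans[OF norm_sum]) (simp add: norm_mult)
  also have "\<dots> \<le> norm x * norm y"
    unfolding norm_vec_def by (rule L2_set_mult_ineq)
  finally show ?thesis .
qed

lemma norm_add_sq: "(norm (x + y))\<^sup>2 = (norm x)\<^sup>2 + (norm y)\<^sup>2 + 2 * Re (cinner x y)"
  for x y :: "complex ^ 'n"
proof -
  have "complex_of_real ((norm (x + y))\<^sup>2) = of_real ((norm x)\<^sup>2 + (norm y)\<^sup>2) + (cinner x y + cnj (cinner x y))"
    by (simp only: of_real_add cinner_self[symmetric] cinner_add cnj_cinner algebra_simps)
  also have "cinner x y + cnj (cinner x y) = of_real (2 * Re (cinner x y))"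
    by (simp add: complex_eq_iff)
  finally show ?thesis unfolding of_real_add[symmetric] of_real_eq_iff .
qed

lemma norm_scale: "norm (c *s x) = cmod c * norm x" for x :: "complex ^ 'n"
  by (simp add: norm_vec_def norm_mult L2_set_right_distrib)

lemma quad_form_cinner: "quad_form A x = cinner x (A *v x)"
  by (simp add: quad_form_def cinner_def)

lemma cinner_ctranspose: "cinner x (A *v y) = cinner (ctranspose A *v x) y"
proof -
  have "cinner x (A *v y) = (\<Sum>i\<in>UNIV. \<Sum>j\<in>UNIV. cnj (x $ i) * (A $ i $ j * y $ j))"
    by (simp add: cinner_def matrix_vector_mult_def sum_distrib_left)
  also have "\<dots> = (\<Sum>j\<in>UNIV. \<Sum>i\<in>UNIV. cnj (x $ i) * (A $ i $ j * y $ j))"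
    by (rule sum.swap)
  also have "\<dots> = cinner (ctranspose A *v x) y"
    by (simp add: cinner_def matrix_vector_mult_def ctranspose_def sum_distrib_left sum_distrib_right mult_ac)
  finally show ?thesis .
qed

lemma ctranspose_ctranspose [simp]: "ctranspose (ctranspose A) = A"
  by (simp add: ctranspose_def vec_eq_iff)

lemma matrix_eqI_cinner:
  fixes A B :: "complex ^ 'n ^ 'n"
  assumes "\<And>x y. cinner x (A *v y) = cinner x (B *v y)"
  shows "A = B"
proof -
  have "A *v y = B *v y" for y
  proof -
    have "cinner (A *v y - B *v y) (A *v y - B *v y) = 0"
      using assms[of "A *v y - B *v y" y] by (simp add: cinner_diff(1)[of "A *v y - B *v y"])
    then show ?thesis by (simp add: cinner_self)
  qed
  then show ?thesis by (simp add: matrix_eq)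
qed

section \<open>Inverses, determinants and evaluation of matrix polynomials\<close>

lemma det_nz_inv:
  fixes A :: "'a::field ^ 'n ^ 'n"
  assumes "det A \<noteq> 0"
  shows "A ** matrix_inv A = mat 1" "matrix_inv A ** A = mat 1"
proof -
  have "\<exists>B. A ** B = mat 1 \<and> B ** A = mat 1"
    using assms unfolding invertible_det_nz[symmetric] invertible_def .
  then have "A ** matrix_inv A = mat 1 \<and> matrix_inv A ** A = mat 1"
    unfolding matrix_inv_def by (rule someI_ex)
  then show "A ** matrix_inv A = mat 1" "matrix_inv A ** A = mat 1" by auto
qed

lemma det_nz_inv_vec:
  fixes A :: "'a::field ^ 'n ^ 'n"
  assumes "det A \<noteq> 0"
  shows "A *v (matrix_inv A *v x) = x" "matrix_inv A *v (A *v x) = x"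
  using det_nz_inv[OF assms] by (simp_all add: matrix_vector_mul_assoc)

lemma det_zero_iff_kernel:
  fixes A :: "'a::field ^ 'n ^ 'n"
  shows "det A = 0 \<longleftrightarrow> (\<exists>x. x \<noteq> 0 \<and> A *v x = 0)"
  using matrix_left_invertible_ker[of A] invertible_det_nz[of A] invertible_left_inverse[of A] by blast

text \<open>A ring homomorphism passes through the Leibniz formula. It is applied to evaluation at a
  point, to \<open>to_fract\<close> and to the embedding of constants.\<close>

lemma det_map_matrix:
  fixes h :: "'a::comm_ring_1 \<Rightarrow> 'b::comm_ring_1"
  assumes "h 0 = 0" "h 1 = 1" "\<And>x y. h (x + y) = h x + h y" "\<And>x y. h (x * y) = h x * h y" "\<And>x. h (- x) = - h x"
  shows "det (map_matrix h A) = h (det A)"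
proof -
  have s: "h (sum f S) = (\<Sum>x\<in>S. h (f x))" if "finite S" for f and S :: "('n \<Rightarrow> 'n) set"
    using that by (induction S rule: finite_induct) (simp_all add: assms)
  have p: "h (prod f S) = (\<Prod>x\<in>S. h (f x))" if "finite S" for f and S :: "'n set"
    using that by (induction S rule: finite_induct) (simp_all add: assms)
  have g: "h (of_int (sign p)) = of_int (sign p)" for p :: "'n \<Rightarrow> 'n"
    by (simp add: sign_def assms)
  show ?thesis
    unfolding det_def by (simp add: s p g assms)
qed

lemma mp_eval_nth [simp]: "mp_eval F z $ i $ j = poly (F $ i $ j) z"
  by (simp add: mp_eval_def)

lemma mp_coeff_nth [simp]: "mp_coeff F k $ i $ j = coeff (F $ i $ j) k"
  by (simp add: mp_coeff_def)

lemma det_mp_eval: "det (mp_eval F z) = poly (det F) z"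
  unfolding mp_eval_def by (rule det_map_matrix) simp_all

lemma mp_zeros_iff: "z \<in> mp_zeros F \<longleftrightarrow> poly (det F) z = 0"
  by (simp add: mp_zeros_def det_mp_eval)

lemma mp_eval_mult: "mp_eval (F ** G) z = mp_eval F z ** mp_eval G z"
  by (simp add: vec_eq_iff matrix_matrix_mult_def poly_sum)

lemma mp_eval_add: "mp_eval (F + G) z = mp_eval F z + mp_eval G z"
  by (simp add: vec_eq_iff)

lemma even_odd_parts_mult_vec:
  assumes "even_odd_parts F Fe Fo"
  shows "mp_eval F z *v x = mp_eval Fe (z\<^sup>2) *v x + z *s (mp_eval Fo (z\<^sup>2) *v x)"
proof -
  have "mp_eval F z $ i $ j = mp_eval Fe (z\<^sup>2) $ i $ j + z * mp_eval Fo (z\<^sup>2) $ i $ j" for i j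
    using assms unfolding even_odd_parts_def by blast
  then show ?thesis
    by (simp add: vec_eq_iff matrix_vector_mult_def sum.distrib[symmetric] sum_distrib_left algebra_simps del: mp_eval_nth)
qed

text \<open>By Cramer's rule the numerators \<open>P k\<close> do not depend on \<open>z\<close>,
  although \<open>matrix_inv\<close> is taken at each point separately.\<close>

lemma mp_inv_vec_rational:
  obtains P where "\<And>z k. poly (det F) z \<noteq> 0 \<Longrightarrow> (matrix_inv (mp_eval F z) *v v) $ k = poly (P k) z / poly (det F) z"
proof
  fix z k assume "poly (det F) z \<noteq> 0"
  then have nz: "det (mp_eval F z) \<noteq> 0" by (simp add: det_mp_eval)
  have "matrix_inv (mp_eval F z) *v v = (\<chi> k. det (\<chi> i j. if j = k then v $ i else mp_eval F z $ i $ j) / det (mp_eval F z))"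
    using det_nz_inv_vec(1)[OF nz] cramer[OF nz] by blast
  moreover have "(\<chi> i j. if j = k then v $ i else mp_eval F z $ i $ j) = mp_eval (\<chi> i j. if j = k then [:v $ i:] else F $ i $ j) z" for k
    by (simp add: vec_eq_iff)
  ultimately show "(matrix_inv (mp_eval F z) *v v) $ k = poly (det (\<chi> i j. if j = k then [:v $ i:] else F $ i $ j)) z / poly (det F) z"
    by (simp add: det_mp_eval del: mp_eval_nth)
qed

text \<open>\<open>rat_eval\<close> uses the reduced fraction \<open>n / d\<close>, and
  \<open>n * b = a * d\<close>. A zero of \<open>d\<close> at \<open>z\<close> would also be one of
  \<open>n\<close>, because \<open>b\<close> does not vanish there; this contradicts
  coprimality.\<close>

lemma rat_eval_quotient:
  assumes r: "r * to_fract b = to_fract a" and b: "poly b z \<noteq> 0"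
  shows "z \<notin> rat_poles r" "rat_eval r z = poly a z / poly b z"
proof -
  define n where "n = fst (quot_of_fract r)"
  define d where "d = snd (quot_of_fract r)"
  have d0: "d \<noteq> 0" by (simp add: d_def)
  have "r = to_fract n / to_fract d"
    by (simp add: n_def d_def Fract_conv_to_fract[symmetric])
  then have "to_fract n * to_fract b = to_fract a * to_fract d"
    using r[symmetric] d0 by simp
  then have "to_fract (n * b) = to_fract (a * d)" by simp
  then have eq: "n * b = a * d" unfolding to_fract_eq_iff .
  have co: "coprime n d" unfolding n_def d_def by (rule coprime_quot_of_fract)
  have dz: "poly d z \<noteq> 0"
  proof
    assume dz: "poly d z = 0"
    then have "poly n z * poly b z = 0" by (metis eq poly_mult mult_zero_right)
    then have "poly n z = 0" using b by simp
    then have "[:-z, 1:] dvd n" "[:-z, 1:] dvd d" using dz by (simp_all add: poly_eq_0_iff_dvd)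
    then have "is_unit [:-z, 1:]" using co by (rule coprime_common_divisor[rotated])
    then show False by (simp add: is_unit_pCons_iff)
  qed
  show "z \<notin> rat_poles r" using dz by (simp add: rat_poles_def d_def)
  have "poly n z * poly b z = poly a z * poly d z" by (metis eq poly_mult)
  then show "rat_eval r z = poly a z / poly b z"
    unfolding rat_eval_def n_def[symmetric] d_def[symmetric] using b dz by (simp add: field_simps)
qed

lemma matrix_inv_cramer:
  fixes A :: "'a::field ^ 'n ^ 'n"
  assumes "det A \<noteq> 0"
  shows "matrix_inv A $ k $ j = det (\<chi> i l. if l = k then axis j 1 $ i else A $ i $ l) / det A"
proof -
  have "matrix_inv A *v axis j 1 = (\<chi> k. det (\<chi> i l. if l = k then axis j 1 $ i else A $ i $ l) / det A)"
    using det_nz_inv_vec(1)[OF assms] cramer[OF assms] by blast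
  then have "(matrix_inv A *v axis j 1) $ k = det (\<chi> i l. if l = k then axis j 1 $ i else A $ i $ l) / det A"
    by simp
  moreover have "(matrix_inv A *v axis j 1) $ k = matrix_inv A $ k $ j"
    by (simp add: matrix_vector_mult_def axis_def if_distrib cong: if_cong)
  ultimately show ?thesis by simp
qed

text \<open>The inverse in \<open>assoc_rational\<close> is formed over the field of fractions.
  Cramer's rule gives it and the pointwise inverse the same numerators \<open>c k j\<close> over the
  denominator \<open>det Fe\<close>, so formal and pointwise quotients agree.\<close>

lemma rm_eval_assoc_rational:
  fixes Fe Fo :: "'p::finite matpoly"
  assumes nz: "poly (det Fe) z \<noteq> 0"
  shows "z \<notin> rm_poles (assoc_rational Fe Fo)"
    and "rm_eval (assoc_rational Fe Fo) z = - (mp_eval Fo z ** matrix_inv (mp_eval Fe z))"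
proof -
  define M where "M = map_matrix to_fract Fe"
  define R where "R = assoc_rational Fe Fo"
  define c :: "'p \<Rightarrow> 'p \<Rightarrow> complex poly" where
    "c = (\<lambda>k j. det (\<chi> i l. if l = k then axis j 1 $ i else Fe $ i $ l))"
  have dtf: "det (map_matrix to_fract A) = to_fract (det A)" for A :: "complex poly ^ 'p ^ 'p"
    by (rule det_map_matrix) simp_all
  have detM: "det M = to_fract (det Fe)"
    unfolding M_def by (rule dtf)
  have d0: "det Fe \<noteq> 0" using nz by auto
  then have M0: "det M \<noteq> 0" by (simp add: detM)
  have c: "matrix_inv M $ k $ j * to_fract (det Fe) = to_fract (c k j)" for k j
  proof -
    have "(\<chi> i l. if l = k then axis j 1 $ i else M $ i $ l)
        = map_matrix to_fract (\<chi> i l. if l = k then axis j 1 $ i else Fe $ i $ l)"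
      by (simp add: vec_eq_iff M_def axis_def)
    then show ?thesis
      using matrix_inv_cramer[OF M0, of k j] d0 unfolding c_def by (simp add: dtf detM)
  qed
  have z0: "det (mp_eval Fe z) \<noteq> 0" using nz by (simp add: det_mp_eval)
  have cz: "matrix_inv (mp_eval Fe z) $ k $ j = poly (c k j) z / poly (det Fe) z" for k j
  proof -
    have "(\<chi> i l. if l = k then axis j 1 $ i else mp_eval Fe z $ i $ l)
        = mp_eval (\<chi> i l. if l = k then axis j 1 $ i else Fe $ i $ l) z"
      by (simp add: vec_eq_iff axis_def)
    then show ?thesis
      unfolding c_def matrix_inv_cramer[OF z0] by (simp only: det_mp_eval)
  qed
  have Rn: "R $ i $ j = - (\<Sum>k\<in>UNIV. to_fract (Fo $ i $ k) * matrix_inv M $ k $ j)" for i j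
    by (simp add: R_def assoc_rational_def M_def matrix_matrix_mult_def)
  have ts: "to_fract (sum f S) = (\<Sum>k\<in>S. to_fract (f k))" if "finite S" for f and S :: "'p set"
    using that by (induction S rule: finite_induct) simp_all
  define b where "b = (\<lambda>i j. - (\<Sum>k\<in>UNIV. Fo $ i $ k * c k j))"
  have Rb: "R $ i $ j * to_fract (det Fe) = to_fract (b i j)" for i j
    by (simp add: Rn b_def ts c[symmetric] sum_distrib_right mult.assoc)
  show "z \<notin> rm_poles (assoc_rational Fe Fo)"
    unfolding rm_poles_def R_def[symmetric] using rat_eval_quotient(1)[OF Rb nz] by blast
  have "rm_eval R z $ i $ j = poly (b i j) z / poly (det Fe) z" for i j
    unfolding rm_eval_def nth_map_matrix by (rule rat_eval_quotient(2)[OF Rb nz])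
  also have "\<dots> i j = (- (mp_eval Fo z ** matrix_inv (mp_eval Fe z))) $ i $ j" for i j
    by (simp add: b_def matrix_matrix_mult_def cz poly_sum sum_divide_distrib)
  finally show "rm_eval (assoc_rational Fe Fo) z = - (mp_eval Fo z ** matrix_inv (mp_eval Fe z))"
    unfolding R_def by (simp add: vec_eq_iff)
qed

section \<open>Coefficients and behaviour at infinity\<close>

lemma coeff_pcompose_square:
  "coeff (pcompose q (monom 1 2)) (2 * k) = coeff q k"
  "coeff (pcompose q (monom 1 2)) (2 * k + 1) = 0"
  for q :: "'a::comm_semiring_1 poly"
proof (induction q arbitrary: k)
  case 0
  { case 1 show ?case by simp next case 2 show ?case by simp }
next
  case (pCons a q)
  { case 1 then show ?case
      using pCons.IH by (cases k) (simp_all add: pcompose_pCons coeff_monom_mult)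
  next case 2 then show ?case
      using pCons.IH(2)[of "k - 1"] by (cases k) (simp_all add: pcompose_pCons coeff_monom_mult) }
qed

lemma even_odd_parts_coeff:
  assumes "even_odd_parts F Fe Fo"
  shows "mp_coeff Fe k = mp_coeff F (2 * k)" "mp_coeff Fo k = mp_coeff F (2 * k + 1)"
proof -
  have F: "F $ i $ j = pcompose (Fe $ i $ j) (monom 1 2) + pCons 0 (pcompose (Fo $ i $ j) (monom 1 2))" for i j
  proof -
    have "poly (F $ i $ j) z = poly (pcompose (Fe $ i $ j) (monom 1 2) + pCons 0 (pcompose (Fo $ i $ j) (monom 1 2))) z" for z
      using assms by (simp add: even_odd_parts_def poly_pcompose poly_monom)
    then show ?thesis unfolding poly_eq_poly_eq_iff[symmetric] by (rule ext)
  qed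
  have "coeff (F $ i $ j) (2 * k) = coeff (Fe $ i $ j) k" for i j
    unfolding F using coeff_pcompose_square[of "Fe $ i $ j" k] coeff_pcompose_square(2)[of "Fo $ i $ j" "k - 1"]
    by (cases k) simp_all
  then show "mp_coeff Fe k = mp_coeff F (2 * k)" by (simp add: vec_eq_iff)
  have "coeff (F $ i $ j) (2 * k + 1) = coeff (Fo $ i $ j) k" for i j
    unfolding F using coeff_pcompose_square(2)[of "Fe $ i $ j" k] coeff_pcompose_square(1)[of "Fo $ i $ j" k]
    by simp
  then show "mp_coeff Fo k = mp_coeff F (2 * k + 1)" by (simp add: vec_eq_iff)
qed

text \<open>Since \<open>mp_degree\<close> is a \<open>LEAST\<close>, some bound must be exhibited
  first; the sum of the degrees of all entries serves.\<close>

lemma mp_coeff_eq_0: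
  assumes "k > mp_degree F"
  shows "mp_coeff F k = 0"
proof -
  have "\<exists>n. \<forall>k>n. mp_coeff F k = 0"
  proof (intro exI allI impI)
    fix k assume k: "k > (\<Sum>i\<in>UNIV. \<Sum>j\<in>UNIV. degree (F $ i $ j))"
    have "degree (F $ i $ j) \<le> (\<Sum>i\<in>UNIV. \<Sum>j\<in>UNIV. degree (F $ i $ j))" for i j
    proof -
      have "degree (F $ i $ j) \<le> (\<Sum>j\<in>UNIV. degree (F $ i $ j))"
        by (rule member_le_sum) auto
      also have "\<dots> \<le> (\<Sum>i\<in>UNIV. \<Sum>j\<in>UNIV. degree (F $ i $ j))"
        by (rule member_le_sum[of i UNIV "\<lambda>i. \<Sum>j\<in>UNIV. degree (F $ i $ j)"]) auto
      finally show ?thesis .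
    qed
    then have "coeff (F $ i $ j) k = 0" for i j
      using k by (intro coeff_eq_0) (meson le_less_trans)
    then show "mp_coeff F k = 0" by (simp add: vec_eq_iff)
  qed
  then have "\<forall>k>mp_degree F. mp_coeff F k = 0" unfolding mp_degree_def by (rule LeastI_ex)
  then show ?thesis using assms by blast
qed

lemma poly_over_power_tendsto:
  fixes q :: "complex poly"
  assumes "\<And>k. k > m \<Longrightarrow> coeff q k = 0"
  shows "((\<lambda>z. poly q z / z ^ m) \<longlongrightarrow> coeff q m) at_infinity"
proof -
  have 1: "((\<lambda>z. coeff q i * (z ^ i / z ^ m)) \<longlongrightarrow> (if i = m then coeff q m else 0)) at_infinity" if "i \<le> m" for i
  proof (cases "i = m")
    case True
    have "\<forall>\<^sub>F z in at_infinity. coeff q m * (z ^ i / z ^ m) = coeff q m"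
      using eventually_not_equal_at_infinity[of 0] by eventually_elim (simp add: True)
    then show ?thesis using True by (simp add: tendsto_eventually)
  next
    case False
    then have lt: "i < m" using that by simp
    have "((\<lambda>z. inverse z ^ (m - i)) \<longlongrightarrow> (0::complex)) at_infinity"
      using tendsto_power[OF tendsto_inverse_0, of "m - i"] lt by (simp add: zero_power)
    moreover have "\<forall>\<^sub>F z in at_infinity. inverse z ^ (m - i) = z ^ i / (z::complex) ^ m"
      using eventually_not_equal_at_infinity[of 0]
    proof eventually_elim
      case (elim z)
      have "z ^ m = z ^ i * z ^ (m - i)" using lt by (simp flip: power_add)
      then show ?case using elim by (simp add: field_simps)
    qed
    ultimately have "((\<lambda>z. z ^ i / z ^ m) \<longlongrightarrow> (0::complex)) at_infinity"
      by (rule Lim_transform_eventually)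
    then have "((\<lambda>z. coeff q i * (z ^ i / z ^ m)) \<longlongrightarrow> coeff q i * 0) at_infinity"
      by (rule tendsto_mult_left)
    then show ?thesis using False by simp
  qed
  have "((\<lambda>z. \<Sum>i\<le>m. coeff q i * (z ^ i / z ^ m)) \<longlongrightarrow> (\<Sum>i\<le>m. if i = m then coeff q m else 0)) at_infinity"
    by (intro tendsto_sum 1) auto
  moreover have "(\<Sum>i\<le>m. coeff q i * (z ^ i / z ^ m)) = poly q z / z ^ m" for z
  proof -
    have "poly q z = (\<Sum>i\<le>m. coeff q i * z ^ i)"
      using arg_cong[OF poly_as_sum_of_monoms'[of q m], of "\<lambda>p. poly p z"] degree_le[of m q] assms
      by (simp add: poly_sum poly_monom)
    then show ?thesis by (simp add: sum_divide_distrib)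
  qed
  ultimately show ?thesis by simp
qed

text \<open>Numerator and denominator of a matrix quotient are scaled by the same number, mostly a
  power of \<open>z\<close>, so that both have finite limits.\<close>

definition mdiv :: "complex \<Rightarrow> complex ^ 'n ^ 'n \<Rightarrow> complex ^ 'n ^ 'n" where
  "mdiv k A = map_matrix (\<lambda>c. c / k) A"

lemma mdiv_mult: "A ** mdiv k B = mdiv k (A ** B)" "mdiv k A ** B = mdiv k (A ** B)"
  by (simp_all add: mdiv_def vec_eq_iff matrix_matrix_mult_def sum_divide_distrib)

lemma mdiv_mult_vec: "mdiv k A *v x = (1 / k) *s (A *v x)"
  by (simp add: mdiv_def vec_eq_iff matrix_vector_mult_def sum_divide_distrib)

lemma det_mdiv_eq_0: "det A = 0 \<Longrightarrow> det (mdiv k A) = 0"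
  unfolding det_zero_iff_kernel mdiv_mult_vec by auto

lemma mp_eval_mdiv_tendsto:
  assumes "\<And>k. k > m \<Longrightarrow> mp_coeff G k = 0"
  shows "((\<lambda>z. mdiv (z ^ m) (mp_eval G z)) \<longlongrightarrow> mp_coeff G m) at_infinity"
proof (intro vec_tendstoI)
  fix i j
  have "coeff (G $ i $ j) k = 0" if "k > m" for k
    using assms[OF that] by (metis mp_coeff_nth zero_index)
  then show "((\<lambda>z. mdiv (z ^ m) (mp_eval G z) $ i $ j) \<longlongrightarrow> mp_coeff G m $ i $ j) at_infinity"
    by (simp add: mdiv_def poly_over_power_tendsto)
qed

lemma tendsto_det:
  fixes A :: "'a \<Rightarrow> complex ^ 'n ^ 'n"
  assumes "(A \<longlongrightarrow> L) F"
  shows "((\<lambda>x. det (A x)) \<longlongrightarrow> det L) F"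
  unfolding det_def by (intro tendsto_intros tendsto_vec_nth assms)

lemma tendsto_matrix_mult:
  fixes A B :: "'a \<Rightarrow> complex ^ 'n ^ 'n"
  assumes "(A \<longlongrightarrow> L) F" "(B \<longlongrightarrow> M) F"
  shows "((\<lambda>x. A x ** B x) \<longlongrightarrow> L ** M) F"
proof (intro vec_tendstoI)
  show "((\<lambda>x. (A x ** B x) $ i $ j) \<longlongrightarrow> (L ** M) $ i $ j) F" for i j
    unfolding matrix_matrix_mult_def by simp (intro tendsto_intros tendsto_vec_nth assms)
qed

lemma tendsto_matrix_vec:
  fixes A :: "'a \<Rightarrow> complex ^ 'n ^ 'n"
  assumes "(A \<longlongrightarrow> L) F" "(x \<longlongrightarrow> v) F"
  shows "((\<lambda>t. A t *v x t) \<longlongrightarrow> L *v v) F"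
proof (intro vec_tendstoI)
  show "((\<lambda>t. (A t *v x t) $ i) \<longlongrightarrow> (L *v v) $ i) F" for i
    unfolding matrix_vector_mult_def by simp (intro tendsto_intros tendsto_vec_nth assms)
qed

lemma tendsto_cinner:
  assumes "(x \<longlongrightarrow> u) F" "(y \<longlongrightarrow> v) F"
  shows "((\<lambda>t. cinner (x t) (y t)) \<longlongrightarrow> cinner u v) F"
  unfolding cinner_def by (intro tendsto_intros tendsto_vec_nth assms)

lemma tendsto_matrix_inv:
  fixes A :: "'a \<Rightarrow> complex ^ 'n ^ 'n"
  assumes A: "(A \<longlongrightarrow> L) F" and L: "det L \<noteq> 0"
  shows "((\<lambda>x. matrix_inv (A x)) \<longlongrightarrow> matrix_inv L) F"
proof (intro vec_tendstoI)
  fix k j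
  define h where "h = (\<lambda>M :: complex ^ 'n ^ 'n. (\<chi> i l. if l = k then axis j 1 $ i else M $ i $ l) :: complex ^ 'n ^ 'n)"
  have "((\<lambda>x. h (A x)) \<longlongrightarrow> h L) F"
  proof (intro vec_tendstoI)
    show "((\<lambda>x. h (A x) $ i $ l) \<longlongrightarrow> h L $ i $ l) F" for i l
      using tendsto_vec_nth[OF tendsto_vec_nth[OF A]] by (simp add: h_def)
  qed
  then have "((\<lambda>x. det (h (A x)) / det (A x)) \<longlongrightarrow> det (h L) / det L) F"
    by (intro tendsto_divide tendsto_det A L)
  moreover have "\<forall>\<^sub>F x in F. det (A x) \<noteq> 0"
    by (rule tendsto_imp_eventually_ne[OF tendsto_det[OF A] L])
  then have "\<forall>\<^sub>F x in F. det (h (A x)) / det (A x) = matrix_inv (A x) $ k $ j"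
    by eventually_elim (simp add: matrix_inv_cramer h_def)
  ultimately show "((\<lambda>x. matrix_inv (A x) $ k $ j) \<longlongrightarrow> matrix_inv L $ k $ j) F"
    unfolding matrix_inv_cramer[OF L] h_def by (rule Lim_transform_eventually)
qed

lemma eventually_poly_nz_at_infinity:
  fixes q :: "complex poly"
  assumes "q \<noteq> 0"
  shows "\<forall>\<^sub>F z in at_infinity. poly q z \<noteq> 0"
proof -
  have "bounded {z. poly q z = 0}" using poly_roots_finite[OF assms] by (rule finite_imp_bounded)
  then obtain b where "\<And>z. poly q z = 0 \<Longrightarrow> cmod z \<le> b" unfolding bounded_iff by blast
  then have "\<And>z. cmod z \<ge> b + 1 \<Longrightarrow> poly q z \<noteq> 0" by force
  then show ?thesis unfolding eventually_at_infinity by blast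
qed

lemma eventually_poly_nz_at:
  fixes q :: "complex poly"
  assumes "q \<noteq> 0"
  shows "\<forall>\<^sub>F z in at w. poly q z \<noteq> 0"
  using islimpt_finite[OF poly_roots_finite[OF assms], of w] unfolding islimpt_iff_eventually by simp

text \<open>The determinant of \<open>G(z) / z^m\<close> tends to \<open>det (mp_coeff G m)\<close>
  at infinity, so \<open>det G\<close> cannot be the zero polynomial.\<close>

lemma mp_regular_leading_coeff:
  assumes "\<And>k. k > m \<Longrightarrow> mp_coeff G k = 0" and L: "det (mp_coeff G m) \<noteq> 0"
  shows "mp_regular G"
  unfolding mp_regular_def
proof
  assume "det G = 0"
  then have "det (mdiv (z ^ m) (mp_eval G z)) = 0" for z
    by (intro det_mdiv_eq_0) (simp add: det_mp_eval)
  then have "((\<lambda>z::complex. 0) \<longlongrightarrow> det (mp_coeff G m)) at_infinity"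
    using tendsto_det[OF mp_eval_mdiv_tendsto[of m G]] assms(1) by simp
  then have "det (mp_coeff G m) = 0"
    by (rule tendsto_unique[OF trivial_limit_at_infinity _ tendsto_const])
  then show False using L by simp
qed

text \<open>The scalar cancels in the quotient. By continuity of the determinant the scaled
  denominator is eventually invertible, and then so is \<open>B x\<close>.\<close>

lemma tendsto_matrix_quotient:
  fixes A B :: "'a \<Rightarrow> complex ^ 'n ^ 'n"
  assumes A: "((\<lambda>x. mdiv (k x) (A x)) \<longlongrightarrow> L) F" and B: "((\<lambda>x. mdiv (k x) (B x)) \<longlongrightarrow> M) F"
    and M: "det M \<noteq> 0"
  shows "((\<lambda>x. A x ** matrix_inv (B x)) \<longlongrightarrow> L ** matrix_inv M) F"
proof -
  have lim: "((\<lambda>x. mdiv (k x) (A x) ** matrix_inv (mdiv (k x) (B x))) \<longlongrightarrow> L ** matrix_inv M) F"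
    by (intro tendsto_matrix_mult tendsto_matrix_inv A B M)
  have "\<forall>\<^sub>F x in F. det (mdiv (k x) (B x)) \<noteq> 0"
    by (rule tendsto_imp_eventually_ne[OF tendsto_det[OF B] M])
  then have "\<forall>\<^sub>F x in F. mdiv (k x) (A x) ** matrix_inv (mdiv (k x) (B x)) = A x ** matrix_inv (B x)"
  proof eventually_elim
    case (elim x)
    then have nz: "det (B x) \<noteq> 0" using det_mdiv_eq_0 by blast
    define X where "X = A x ** matrix_inv (B x)"
    have "X ** B x = A x"
      unfolding X_def by (simp add: det_nz_inv[OF nz] flip: matrix_mul_assoc)
    then have "X ** mdiv (k x) (B x) = mdiv (k x) (A x)" by (simp add: mdiv_mult)
    then show ?case
      unfolding X_def[symmetric] by (metis det_nz_inv(1)[OF elim] matrix_mul_assoc matrix_mul_rid)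
  qed
  with lim show ?thesis by (rule Lim_transform_eventually)
qed

lemma rm_eval_assoc_rational_tendsto:
  assumes Fe: "\<And>k. k > m \<Longrightarrow> mp_coeff Fe k = 0" and Fo: "\<And>k. k > m \<Longrightarrow> mp_coeff Fo k = 0"
    and L: "det (mp_coeff Fe m) \<noteq> 0"
  shows "(rm_eval (assoc_rational Fe Fo) \<longlongrightarrow> - (mp_coeff Fo m ** matrix_inv (mp_coeff Fe m))) at_infinity"
proof -
  have lim: "((\<lambda>z. - (mp_eval Fo z ** matrix_inv (mp_eval Fe z)))
      \<longlongrightarrow> - (mp_coeff Fo m ** matrix_inv (mp_coeff Fe m))) at_infinity"
    using mp_eval_mdiv_tendsto[OF Fo] mp_eval_mdiv_tendsto[OF Fe] L
    by (intro tendsto_minus tendsto_matrix_quotient) auto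
  have "mp_regular Fe" using Fe L by (rule mp_regular_leading_coeff)
  then have "\<forall>\<^sub>F z in at_infinity. poly (det Fe) z \<noteq> 0"
    unfolding mp_regular_def by (rule eventually_poly_nz_at_infinity)
  then have "\<forall>\<^sub>F z in at_infinity. - (mp_eval Fo z ** matrix_inv (mp_eval Fe z)) = rm_eval (assoc_rational Fe Fo) z"
    by eventually_elim (simp add: rm_eval_assoc_rational(2))
  with lim show ?thesis by (rule Lim_transform_eventually)
qed

lemma tendsto_mp_eval:
  assumes "(f \<longlongrightarrow> w) F"
  shows "((\<lambda>t. mp_eval G (f t)) \<longlongrightarrow> mp_eval G w) F"
proof (intro vec_tendstoI)
  show "((\<lambda>t. mp_eval G (f t) $ i $ j) \<longlongrightarrow> mp_eval G w $ i $ j) F" for i j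
    by simp (intro tendsto_intros assms)
qed

lemma cinner_axis: "cinner (axis i 1) y = y $ i"
  by (simp add: cinner_def axis_def if_distrib[of cnj] if_distrib[of "\<lambda>c. c * _"] cong: if_cong)

lemma matrix_vec_axis: "(A *v axis j (1::'a::comm_semiring_1)) $ i = A $ i $ j"
  by (simp add: matrix_vector_mult_def axis_def if_distrib cong: if_cong)

lemma holomorphic_mp_quotient:
  assumes h: "h holomorphic_on S" and g: "g holomorphic_on S"
    and nz: "\<And>w. w \<in> S \<Longrightarrow> poly (det A) (g w) \<noteq> 0"
  shows "(\<lambda>w. cinner u (mp_eval B (h w) *v (matrix_inv (mp_eval A (g w)) *v v))) holomorphic_on S"
proof -
  obtain P where P: "\<And>z k. poly (det A) z \<noteq> 0 \<Longrightarrow>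
      (matrix_inv (mp_eval A z) *v v) $ k = poly (P k) z / poly (det A) z"
    using mp_inv_vec_rational[of A v] by blast
  have "(\<lambda>w. \<Sum>i\<in>UNIV. cnj (u $ i) * (\<Sum>k\<in>UNIV. poly (B $ i $ k) (h w) * (poly (P k) (g w) / poly (det A) (g w))))
      holomorphic_on S"
    by (intro holomorphic_intros h g nz)
  then show ?thesis
    by (rule holomorphic_transform) (simp add: cinner_def matrix_vector_mult_def[of "mp_eval B _"] P nz)
qed

lemma quad_form_imaginary_part:
  "quad_form (map_matrix (\<lambda>c. c / (2 * \<i>)) (A - ctranspose A)) x = of_real (Im (cinner x (A *v x)))"
proof -
  define q where "q = cinner x (A *v x)"
  have "cinner x (ctranspose A *v x) = cnj q"
    unfolding q_def cinner_ctranspose[of x "ctranspose A"] by (simp add: cnj_cinner)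
  then have "cinner x ((A - ctranspose A) *v x) = q - cnj q"
    by (simp add: matrix_vector_mult_diff_rdistrib cinner_diff q_def)
  then have "quad_form (map_matrix (\<lambda>c. c / (2 * \<i>)) (A - ctranspose A)) x = (q - cnj q) / (2 * \<i>)"
    unfolding quad_form_cinner mdiv_def[symmetric] mdiv_mult_vec cinner_scale by simp
  also have "\<dots> = of_real (Im q)" by (simp add: complex_eq_iff Re_divide Im_divide)
  finally show ?thesis unfolding q_def .
qed

lemma self_adjoint_imaginary_part:
  "self_adjoint_matrix (map_matrix (\<lambda>c. c / (2 * \<i>)) (A - ctranspose A))"
  unfolding self_adjoint_matrix_def
  by (auto simp: vec_eq_iff ctranspose_def complex_eq_iff Re_divide Im_divide field_simps)

lemma nonneg_definite_imaginary_part: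
  "nonneg_definite (map_matrix (\<lambda>c. c / (2 * \<i>)) (A - ctranspose A))
    \<longleftrightarrow> (\<forall>x. 0 \<le> Im (cinner x (A *v x)))"
  unfolding nonneg_definite_def quad_form_imaginary_part Re_complex_of_real
  using self_adjoint_imaginary_part by blast

lemma ctranspose_minus: "ctranspose (- A) = - ctranspose A"
  by (simp add: ctranspose_def vec_eq_iff)

lemma eventually_of_real_poly_nz:
  fixes q :: "complex poly"
  assumes "q \<noteq> 0"
  shows "\<forall>\<^sub>F t in at (t0::real). poly q (of_real t) \<noteq> 0"
proof -
  have "filterlim complex_of_real (at (of_real t0)) (at t0)"
    unfolding filterlim_at by (auto intro!: tendsto_intros simp: eventually_at_filter)
  with eventually_poly_nz_at[OF assms] show ?thesis by (rule eventually_compose_filterlim)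
qed

lemma matrix_vec_minus: "(- A) *v x = - (A *v x)" for A :: "'a::comm_ring_1 ^ 'n ^ 'm"
  by (simp add: vec_eq_iff matrix_vector_mult_def sum_negf)

definition mp_reflect :: "'p::finite matpoly \<Rightarrow> 'p matpoly" where
  "mp_reflect G = map_matrix (\<lambda>q. pcompose q [:0, - 1:]) G"

lemma mp_eval_reflect: "mp_eval (mp_reflect G) z = mp_eval G (- z)"
  by (simp add: vec_eq_iff mp_reflect_def poly_pcompose)

lemma mp_coeff_reflect: "mp_coeff (mp_reflect G) k $ i $ j = (- 1) ^ k * mp_coeff G k $ i $ j"
  by (simp add: mp_reflect_def coeff_pcompose_linear)

lemma poly_eqI_positive_reals:
  fixes p q :: "complex poly"
  assumes "\<And>r::real. r > 0 \<Longrightarrow> poly p (of_real r) = poly q (of_real r)"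
  shows "p = q"
proof (rule ccontr)
  assume "p \<noteq> q"
  then have "finite {z. poly (p - q) z = 0}" by (intro poly_roots_finite) simp
  moreover have "complex_of_real ` {0<..} \<subseteq> {z. poly (p - q) z = 0}" using assms by auto
  ultimately have "finite (complex_of_real ` {0<..})" by (rule rev_finite_subset)
  then have "finite {(0::real)<..}" by (rule finite_imageD) (auto simp: inj_on_def)
  then show False by (simp add: infinite_Ioi)
qed

lemma poly_tendsto_0_at_infinity:
  fixes q :: "complex poly"
  assumes "(poly q \<longlongrightarrow> 0) at_infinity"
  shows "q = 0"
proof (cases "degree q > 0")
  case True
  then have "filterlim (poly q) at_infinity at_infinity" by (rule filterlim_poly_at_infinity)
  then show ?thesis
    using not_tendsto_and_filterlim_at_infinity[OF trivial_limit_at_infinity assms] by blast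
next
  case False
  then obtain a where a: "q = [:a:]" by (metis degree_eq_zeroE neq0_conv)
  then have "poly q = (\<lambda>z. a)" by auto
  then have "((\<lambda>z::complex. a) \<longlongrightarrow> 0) at_infinity" using assms by simp
  then have "a = 0" using tendsto_unique[OF trivial_limit_at_infinity tendsto_const] by blast
  then show ?thesis using a by simp
qed

lemma norm_diff_sq: "(norm (x - y))\<^sup>2 = (norm x)\<^sup>2 + (norm y)\<^sup>2 - 2 * Re (cinner x y)"
  for x y :: "complex ^ 'n"
  using norm_add_sq[of x "- y"] by (simp add: cinner_def sum_negf)

text \<open>Equality case of Cauchy-Schwarz: the scalar product of \<open>v\<close> and
  \<open>t\<close> is \<open>- |v|^2\<close>, so \<open>|v + t|^2 = |t|^2 - |v|^2\<close>, which is
  at most 0.\<close>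

lemma norm_add_eq_0:
  fixes v t :: "complex ^ 'n"
  assumes "cinner v (v + t) = 0" "norm t \<le> norm v"
  shows "v + t = 0"
proof -
  have "cinner v t = - of_real ((norm v)\<^sup>2)"
    using assms(1) unfolding cinner_add cinner_self by (simp add: eq_neg_iff_add_eq_0 add.commute)
  then have "(norm (v + t))\<^sup>2 = (norm t)\<^sup>2 - (norm v)\<^sup>2"
    unfolding norm_add_sq by (simp del: of_real_power)
  also have "\<dots> \<le> 0" using assms(2) by (simp add: power_mono)
  finally show ?thesis by simp
qed

section \<open>Greatest common divisors and simplicity of matrix polynomials\<close>

lemma det_replace_row_diff:
  fixes G :: "'a::comm_ring_1 ^ 'n ^ 'n"
  shows "det (\<chi> i. if i = k then r - a *s G $ k else G $ i)
    = det (\<chi> i. if i = k then r else G $ i) - a * det G"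
proof -
  have "det (\<chi> i. if i = k then r - a *s G $ k else G $ i)
      = det (\<chi> i. if i = k then r + (- a) *s G $ k else G $ i)"
    by (rule arg_cong[of _ _ det]) (simp add: vec_eq_iff)
  also have "\<dots> = det (\<chi> i. if i = k then r else G $ i) + det (\<chi> i. if i = k then (- a) *s G $ k else G $ i)"
    using det_row_add[of k "\<lambda>_. r" "\<lambda>_. (- a) *s G $ k" "\<lambda>i. G $ i"] .
  also have "det (\<chi> i. if i = k then (- a) *s G $ k else G $ i) = - a * det (\<chi> i. if i = k then G $ k else G $ i)"
    using det_row_mul[of k "- a" "\<lambda>_. G $ k" "\<lambda>i. G $ i"] .
  also have "(\<chi> i. if i = k then G $ k else G $ i) = G" by (simp add: vec_eq_iff)
  finally show ?thesis by simp
qed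

text \<open>Among the matrices whose rows lie in a given submodule and whose determinant does not vanish,
  one with a determinant of least degree has rows that generate the submodule: by Cramer's rule, the
  coordinates of a row \<open>r\<close> are \<open>D\<^sub>k / det G\<close>, where \<open>D\<^sub>k\<close> is the determinant with \<open>r\<close> as row \<open>k\<close>, and
  a nonzero remainder of \<open>D\<^sub>k\<close> modulo \<open>det G\<close> would be a determinant of smaller degree.\<close>

lemma submodule_generated_by_rows:
  fixes G :: "complex poly ^ 'n ^ 'n"
  assumes sub: "\<And>r r' a. r \<in> M \<Longrightarrow> r' \<in> M \<Longrightarrow> r - a *s r' \<in> M"
    and G: "\<And>i. G $ i \<in> M" "det G \<noteq> 0"
    and min: "\<And>H. (\<And>i. H $ i \<in> M) \<Longrightarrow> det H \<noteq> 0 \<Longrightarrow> degree (det G) \<le> degree (det H)"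
    and r: "r \<in> M"
  shows "\<exists>q. r = q v* G"
proof -
  define D where "D = (\<lambda>k. det (\<chi> i. if i = k then r else G $ i))"
  have dvd: "det G dvd D k" for k
  proof (rule ccontr)
    assume nd: "\<not> det G dvd D k"
    define H where "H = (\<chi> i. if i = k then r - (D k div det G) *s G $ k else G $ i)"
    have "det H = D k mod det G"
      unfolding H_def det_replace_row_diff D_def by (simp add: minus_div_mult_eq_mod)
    moreover have "D k mod det G \<noteq> 0" using nd by (simp add: dvd_eq_mod_eq_0)
    moreover have "H $ i \<in> M" for i unfolding H_def using sub[OF r G(1)] G(1) by simp
    ultimately have "degree (det G) \<le> degree (D k mod det G)" using min[of H] by simp
    then show False using degree_mod_less'[OF G(2) \<open>D k mod det G \<noteq> 0\<close>] by simp
  qed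
  define q where "q = (\<lambda>k. D k div det G)"
  have q: "D k = q k * det G" for k unfolding q_def using dvd[of k] by simp
  \<comment> \<open>Coordinates of \<open>r\<close> with respect to the rows of \<open>G\<close>
    exist over the field of fractions; Cramer's rule identifies them with the polynomials
    \<open>q k\<close>.\<close>
  define Gf where "Gf = map_matrix to_fract G"
  define rf :: "complex poly fract ^ 'n" where "rf = (\<chi> j. to_fract (r $ j))"
  have dtf: "det (map_matrix to_fract A) = to_fract (det A)" for A :: "complex poly ^ 'n ^ 'n"
    by (rule det_map_matrix) simp_all
  have Gf: "det Gf = to_fract (det G)" unfolding Gf_def by (rule dtf)
  then have Gf0: "det Gf \<noteq> 0" using G by simp
  define c where "c = rf v* matrix_inv Gf"
  have "c v* Gf = rf" unfolding c_def by (simp add: vector_matrix_mul_assoc det_nz_inv[OF Gf0])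
  then have rfs: "rf = (\<Sum>i\<in>UNIV. c $ i *s row i Gf)"
    by (auto simp: vec_eq_iff vector_matrix_mult_def row_def mult.commute)
  have "c $ k = to_fract (q k)" for k
  proof -
    have "c $ k * det Gf = det (\<chi> i. if i = k then rf else row i Gf)"
      unfolding rfs by (rule cramer_lemma_transpose[symmetric])
    also have "(\<chi> i. if i = k then rf else row i Gf) = map_matrix to_fract (\<chi> i. if i = k then r else G $ i)"
      by (simp add: vec_eq_iff row_def Gf_def rf_def)
    also have "det \<dots> = to_fract (D k)" unfolding dtf D_def ..
    also have "\<dots> = to_fract (q k) * det Gf" by (simp add: Gf q)
    finally show ?thesis using Gf0 by simp
  qed
  then have "to_fract (r $ j) = (\<Sum>i\<in>UNIV. to_fract (q i) * to_fract (G $ i $ j))" for j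
    using arg_cong[OF rfs, of "\<lambda>v. v $ j"] by (simp add: rf_def Gf_def row_def)
  moreover have "to_fract (sum f S) = (\<Sum>k\<in>S. to_fract (f k))" if "finite S" for f and S :: "'n set"
    using that by (induction S rule: finite_induct) simp_all
  ultimately have "to_fract (r $ j) = to_fract (\<Sum>i\<in>UNIV. q i * G $ i $ j)" for j by simp
  then have "r $ j = (\<Sum>i\<in>UNIV. q i * G $ i $ j)" for j unfolding to_fract_eq_iff .
  then have "r = (\<chi> i. q i) v* G" by (simp add: vec_eq_iff vector_matrix_mult_def mult.commute)
  then show ?thesis by blast
qed

lemma matrix_matrix_add_rdistrib: "(A + B) ** C = A ** C + B ** C"
  by (simp add: vec_eq_iff matrix_matrix_mult_def sum.distrib distrib_right)

text \<open>The submodule \<open>M\<close> is spanned by the rows of \<open>A\<close> and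
  \<open>B\<close>; \<open>A\<close> itself is a candidate with nonzero determinant, so a minimal
  one exists and generates \<open>M\<close>. Since \<open>right_coprime\<close> quantifies over all
  divisors with \<open>is_grcd\<close>, it yields information only once such a divisor has been
  produced.\<close>

lemma grcd_combination:
  fixes A B :: "'p::finite matpoly"
  assumes "mp_regular A"
  obtains G Y Z where "is_grcd G A B" "G = Y ** A + Z ** B"
proof -
  define M where "M = {r. \<exists>y z. r = y v* A + z v* B}"
  have sub: "r - a *s r' \<in> M" if r: "r \<in> M" "r' \<in> M" for r r' a
  proof -
    obtain y z y' z' where "r = y v* A + z v* B" "r' = y' v* A + z' v* B"
      using r by (auto simp: M_def)
    then have "r - a *s r' = (y - a *s y') v* A + (z - a *s z') v* B"
      by (simp add: vec_eq_iff vector_matrix_mult_def algebra_simps sum_distrib_left sum_subtractf)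
    then show ?thesis unfolding M_def by blast
  qed
  have row: "(Y ** A + Z ** B) $ i = Y $ i v* A + Z $ i v* B" for Y Z i
    by (simp add: vec_eq_iff vector_matrix_mult_def matrix_matrix_mult_def mult.commute)
  have rowsM: "(Y ** A + Z ** B) $ i \<in> M" for Y Z i unfolding row M_def by blast
  have AM: "A $ i \<in> M" for i using rowsM[of "mat 1" 0 i] by simp
  have BM: "B $ i \<in> M" for i using rowsM[of 0 "mat 1" i] by simp
  define P where "P = (\<lambda>H :: 'p matpoly. (\<forall>i. H $ i \<in> M) \<and> det H \<noteq> 0)"
  have "P A" using AM assms by (simp add: P_def mp_regular_def)
  then obtain G where G: "P G" "\<And>H. P H \<Longrightarrow> degree (det G) \<le> degree (det H)"
    using ex_has_least_nat[of P A "\<lambda>H. degree (det H)"] by blast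
  have gen: "\<exists>q. r = q v* G" if "r \<in> M" for r
    by (rule submodule_generated_by_rows[OF sub _ _ _ that]) (use G in \<open>auto simp: P_def\<close>)
  have div: "right_divisor G H" if H: "\<And>i. H $ i \<in> M" for H
  proof -
    have "\<forall>i. \<exists>q. H $ i = q v* G" using gen[OF H] by blast
    then obtain q where q: "\<And>i. H $ i = q i v* G" by metis
    have "H = (\<chi> i. q i) ** G"
    proof -
      have "H $ i $ j = ((\<chi> i. q i) ** G) $ i $ j" for i j
        unfolding q by (simp add: vector_matrix_mult_def matrix_matrix_mult_def mult.commute)
      then show ?thesis by (simp add: vec_eq_iff)
    qed
    then show ?thesis unfolding right_divisor_def by blast
  qed
  have "\<forall>i. \<exists>y z. G $ i = y v* A + z v* B" using G(1) by (auto simp: P_def M_def)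
  then obtain y z where yz: "\<And>i. G $ i = y i v* A + z i v* B" by metis
  define Y where "Y = (\<chi> i. y i)" define Z where "Z = (\<chi> i. z i)"
  have GYZ: "G = Y ** A + Z ** B"
    unfolding vec_eq_iff[of G] row yz by (simp add: Y_def Z_def)
  have "is_grcd G A B"
    unfolding is_grcd_def right_common_divisor_def
  proof (intro conjI allI impI)
    show "right_divisor G A" using AM by (rule div)
    show "right_divisor G B" using BM by (rule div)
    fix H assume "right_divisor H A \<and> right_divisor H B"
    then obtain C D where "A = C ** H" "B = D ** H" unfolding right_divisor_def by blast
    then have "G = (Y ** C + Z ** D) ** H"
      unfolding GYZ by (simp add: matrix_matrix_add_rdistrib matrix_mul_assoc)
    then show "right_divisor H G" unfolding right_divisor_def by blast
  qed
  then show thesis using GYZ by (rule that)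
qed

text \<open>By the Bezout identity a common kernel vector is annihilated by \<open>G(w)\<close>,
  which is invertible.\<close>

lemma right_coprime_kernel:
  assumes "mp_regular A" "right_coprime A B"
    and "mp_eval A w *v x = 0" "mp_eval B w *v x = 0"
  shows "x = 0"
proof -
  obtain G Y Z where G: "is_grcd G A B" "G = Y ** A + Z ** B"
    using grcd_combination[OF assms(1)] .
  have "det (mp_eval G w) \<noteq> 0" using G(1) assms(2) by (simp add: right_coprime_def unimodular_def)
  moreover have "mp_eval G w *v x = 0"
    unfolding G(2) mp_eval_add mp_eval_mult
    by (simp add: matrix_vector_mult_add_rdistrib assms flip: matrix_vector_mul_assoc)
  ultimately show ?thesis unfolding det_zero_iff_kernel by blast
qed

section \<open>Multiplicity of a zero without Jordan chains\<close>

lemma pderiv_sum': "pderiv (sum h S) = (\<Sum>i\<in>S. pderiv (h i))" for h :: "'i \<Rightarrow> complex poly"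
  by (induction S rule: infinite_finite_induct) (simp_all add: pderiv_add)

text \<open>In a basis of \<open>\<complex>\<^sup>p\<close> adapted to the kernel of \<open>G(\<mu>)\<close>, the columns of \<open>G\<close> that belong to the kernel are
  divisible by \<open>z - \<mu>\<close>. Without Jordan chains of length two the remaining factor of \<open>det G\<close>
  does not vanish at \<open>\<mu>\<close>.\<close>

lemma order_det_eq_nullity:
  fixes G :: "'p::finite matpoly"
  assumes chain: "\<And>x0 x1. mp_eval G \<mu> *v x0 = 0
      \<Longrightarrow> mp_eval G \<mu> *v x1 + mp_eval (map_matrix pderiv G) \<mu> *v x0 = 0 \<Longrightarrow> x0 = 0"
  shows "order \<mu> (det G) = nullity (mp_eval G \<mu>)"
proof -
  define N where "N = {x. mp_eval G \<mu> *v x = 0}"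
  obtain B0 where B0: "B0 \<subseteq> N" "vec.independent B0" "N \<subseteq> vec.span B0" "card B0 = vec.dim N"
    using vec.basis_exists[of N] by blast
  define B where "B = vec.extend_basis B0"
  have B: "B0 \<subseteq> B" "vec.independent B" "vec.span B = UNIV"
    unfolding B_def using vec.extend_basis_superset vec.independent_extend_basis vec.span_extend_basis B0(2) by blast+
  have finB: "finite B" using B(2) by (rule vec.finiteI_independent)
  have "card B = CARD('p)"
    using vec.dim_eq_card_independent[OF B(2)] vec.dim_span[of B] B(3)
    by (simp add: card_cart_basis)
  then obtain q :: "'p \<Rightarrow> complex ^ 'p" where q: "bij_betw q UNIV B"
    using finite_same_card_bij[of "UNIV :: 'p set" B] finB by auto
  have inj: "inj q" using q by (auto simp: bij_betw_def)
  define J where "J = {j. q j \<in> B0}"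
  have qJ: "q ` J = B0" using q B(1) by (auto simp: J_def bij_betw_def)
  then have cardJ: "card J = nullity (mp_eval G \<mu>)"
    using B0(4) card_image[OF inj_on_subset[OF inj], of J] by (simp add: nullity_def N_def)
  have sum0: "c j = 0" if c: "(\<Sum>j\<in>UNIV. c j *s q j) = 0" for c j
  proof -
    have "(\<Sum>b\<in>B. c (inv q b) *s b) = 0"
      using c sum.reindex_bij_betw[OF q, of "\<lambda>b. c (inv q b) *s b"] inj by simp
    then have "c (inv q (q j)) = 0"
      using vec.independentD[OF B(2) finB subset_refl, of "\<lambda>b. c (inv q b)" "q j"] q by (auto simp: bij_betw_def)
    then show ?thesis using inj by simp
  qed
  define Q where "Q = (\<chi> i j. q j $ i)"
  have Qc: "Q *v c = (\<Sum>j\<in>UNIV. c $ j *s q j)" for c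
    by (simp add: Q_def vec_eq_iff matrix_vector_mult_def mult.commute)
  have detQ: "det Q \<noteq> 0"
  proof
    assume "det Q = 0"
    then obtain c where c: "c \<noteq> 0" "Q *v c = 0" unfolding det_zero_iff_kernel by blast
    then have "c $ j = 0" for j using sum0[of "\<lambda>j. c $ j"] by (simp add: Qc)
    then show False using c(1) by (simp add: vec_eq_iff)
  qed
  define Qp :: "'p matpoly" where "Qp = map_matrix (\<lambda>c. [:c:]) Q"
  have detQp: "det Qp = [:det Q:]"
    unfolding Qp_def by (rule det_map_matrix) (simp_all add: one_pCons)
  define g where "g = (\<lambda>i j. (G ** Qp) $ i $ j)"
  have g: "g i j = (\<Sum>k\<in>UNIV. smult (q j $ k) (G $ i $ k))" for i j
    by (simp add: g_def matrix_matrix_mult_def Qp_def Q_def)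
  have g_eval: "poly (g i j) z = (mp_eval G z *v q j) $ i" for i j z
    by (simp add: g poly_sum matrix_vector_mult_def mult.commute)
  have g_deriv: "poly (pderiv (g i j)) z = (mp_eval (map_matrix pderiv G) z *v q j) $ i" for i j z
    by (simp add: g pderiv_sum' pderiv_smult poly_sum matrix_vector_mult_def mult.commute)
  define l where "l = [:- \<mu>, 1:]"
  \<comment> \<open>At \<open>\<mu>\<close> a divided column takes the value
    \<open>G'(\<mu>) q j\<close>, because \<open>g i j\<close> vanishes there.\<close>
  define H where "H = (\<chi> i j. if j \<in> J then g i j div l else g i j)"
  have gJ: "g i j = l * (g i j div l)" if "j \<in> J" for i j
  proof -
    have "mp_eval G \<mu> *v q j = 0" using that B0(1) by (auto simp: J_def N_def)
    then have "l dvd g i j" unfolding l_def by (simp add: poly_eq_0_iff_dvd[symmetric] g_eval)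
    then show ?thesis by simp
  qed
  have "transpose (G ** Qp) = (\<chi> j. (if j \<in> J then l else 1) *s (transpose H) $ j)"
    using gJ by (simp add: vec_eq_iff transpose_def H_def g_def)
  then have "det (G ** Qp) = (\<Prod>j\<in>UNIV. if j \<in> J then l else 1) * det (\<chi> j. transpose H $ j)"
    using det_rows_mul[of "\<lambda>j. if j \<in> J then l else 1" "\<lambda>j. transpose H $ j"] det_transpose[of "G ** Qp"] by simp
  also have "(\<chi> j. transpose H $ j) = transpose H" by simp
  also have "(\<Prod>j\<in>UNIV. if j \<in> J then l else 1) = l ^ card J"
    by (simp add: prod.If_cases)
  finally have detGQ: "smult (det Q) (det G) = l ^ card J * det H"
    by (simp add: det_mul detQp)
  have "poly (det H) \<mu> \<noteq> 0"
  proof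
    assume "poly (det H) \<mu> = 0"
    then have "det (mp_eval H \<mu>) = 0" by (simp add: det_mp_eval)
    then obtain c where c: "c \<noteq> 0" "mp_eval H \<mu> *v c = 0" unfolding det_zero_iff_kernel by blast
    \<comment> \<open>A kernel vector \<open>c\<close> of \<open>H(\<mu>)\<close> is split along
      \<open>J\<close>: \<open>H(\<mu>) c = 0\<close> becomes
      \<open>G(\<mu>) x1 + G'(\<mu>) x0 = 0\<close> with \<open>G(\<mu>) x0 = 0\<close>, which is a
      Jordan chain.\<close>
    define x0 where "x0 = (\<Sum>j\<in>J. c $ j *s q j)"
    define x1 where "x1 = (\<Sum>j\<in>-J. c $ j *s q j)"
    have Hj: "poly (H $ i $ j) \<mu> = (if j \<in> J then (mp_eval (map_matrix pderiv G) \<mu> *v q j) $ i else (mp_eval G \<mu> *v q j) $ i)" for i j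
    proof (cases "j \<in> J")
      case True
      have "poly (pderiv (g i j)) \<mu> = poly (pderiv (l * (g i j div l))) \<mu>" using gJ[OF True] by metis
      also have "\<dots> = poly (g i j div l) \<mu>"
        unfolding pderiv_mult by (simp add: l_def pderiv_pCons)
      finally show ?thesis using True by (simp add: H_def g_deriv)
    qed (simp add: H_def g_eval)
    have lin: "M *v (\<Sum>j\<in>S. c $ j *s q j) = (\<Sum>j\<in>S. c $ j *s (M *v q j))" for M :: "complex ^ 'p ^ 'p" and S
      by (induction S rule: infinite_finite_induct) (simp_all add: matrix_vector_right_distrib vector_scalar_commute)
    have "mp_eval G \<mu> *v x1 + mp_eval (map_matrix pderiv G) \<mu> *v x0 = mp_eval H \<mu> *v c"
    proof -
      have "(mp_eval H \<mu> *v c) $ i = (\<Sum>j\<in>UNIV. c $ j * poly (H $ i $ j) \<mu>)" for i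
        by (simp add: matrix_vector_mult_def mult.commute)
      also have "\<dots> i = (\<Sum>j\<in>J. c $ j * poly (H $ i $ j) \<mu>) + (\<Sum>j\<in>-J. c $ j * poly (H $ i $ j) \<mu>)" for i
        by (subst sum.union_disjoint[symmetric]) (auto simp: Un_commute)
      finally show ?thesis
        unfolding x0_def x1_def lin by (simp add: vec_eq_iff Hj)
    qed
    moreover have "mp_eval G \<mu> *v x0 = 0"
    proof -
      have "mp_eval G \<mu> *v q j = 0" if "j \<in> J" for j using that B0(1) by (auto simp: J_def N_def)
      then show ?thesis unfolding x0_def lin by simp
    qed
    ultimately have x0: "x0 = 0" using chain[of x0 x1] c(2) by simp
    \<comment> \<open>Now \<open>x1\<close> lies in the kernel, hence in the span of the
      \<open>q j\<close> with \<open>j\<close> in \<open>J\<close>, but it is a combination of the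
      other basis vectors. Independence makes \<open>c\<close> vanish off \<open>J\<close>, and
      \<open>x0 = 0\<close> makes it vanish on \<open>J\<close>.\<close>
    then have "mp_eval G \<mu> *v x1 = 0"
      using \<open>mp_eval G \<mu> *v x1 + mp_eval (map_matrix pderiv G) \<mu> *v x0 = mp_eval H \<mu> *v c\<close> c(2) by simp
    then have "x1 \<in> vec.span (q ` J)" using B0(3) qJ by (auto simp: N_def)
    then obtain d where d: "x1 = (\<Sum>b\<in>q ` J. d b *s b)"
      using vec.span_finite[of "q ` J"] by auto
    have d: "x1 = (\<Sum>j\<in>J. d (q j) *s q j)"
      unfolding d using sum.reindex[OF inj_on_subset[OF inj], of J] by simp
    have 1: "(\<Sum>j\<in>UNIV. (if j \<in> J then - d (q j) else c $ j) *s q j) = 0"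
    proof -
      have "(\<Sum>j\<in>UNIV. (if j \<in> J then - d (q j) else c $ j) *s q j)
          = (\<Sum>j\<in>J. (- d (q j)) *s q j) + (\<Sum>j\<in>-J. c $ j *s q j)"
        using sum.union_disjoint[of J "-J" "\<lambda>j. (if j \<in> J then - d (q j) else c $ j) *s q j"] by simp
      also have "\<dots> = 0" using d unfolding x1_def[symmetric] by (simp add: sum_negf)
      finally show ?thesis .
    qed
    have 2: "(\<Sum>j\<in>UNIV. (if j \<in> J then c $ j else 0) *s q j) = 0"
      using sum.union_disjoint[of J "-J" "\<lambda>j. (if j \<in> J then c $ j else 0) *s q j"] x0 by (simp add: x0_def)
    have "c $ j = 0" for j
      using sum0[OF 1, of j] sum0[OF 2, of j] by (cases "j \<in> J") auto
    then show False using c(1) by (simp add: vec_eq_iff)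
  qed
  then have H0: "order \<mu> (det H) = 0" "det H \<noteq> 0" by (auto simp: order_root)
  have "order \<mu> (det G) = order \<mu> (smult (det Q) (det G))"
    using detQ by (simp add: order_smult)
  also have "\<dots> = order \<mu> (l ^ card J) + order \<mu> (det H)"
    unfolding detGQ using H0 by (intro order_mult) (auto simp: l_def)
  also have "order \<mu> (l ^ card J) = card J" unfolding l_def by (rule order_power_n_n)
  finally show ?thesis using H0 cardJ by simp
qed

section \<open>Self-adjoint pairs of even and odd parts\<close>

locale self_adjoint_parts =
  fixes F Fe Fo :: "'p::finite matpoly"
  assumes monic: "mp_monic F" and deg: "mp_degree F \<ge> 1"
    and parts: "even_odd_parts F Fe Fo"
    and regular_Fe: "mp_regular Fe"
    and self_adj: "self_adjoint_rm (assoc_rational Fe Fo)"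
begin

abbreviation "R \<equiv> rm_eval (assoc_rational Fe Fo)"

lemma F_vec: "mp_eval F z *v x = mp_eval Fe (z\<^sup>2) *v x + z *s (mp_eval Fo (z\<^sup>2) *v x)"
  by (rule even_odd_parts_mult_vec[OF parts])

lemma F_neg_vec: "mp_eval F (- z) *v x = mp_eval Fe (z\<^sup>2) *v x - z *s (mp_eval Fo (z\<^sup>2) *v x)"
  unfolding F_vec by (simp add: vec_eq_iff)

lemma regular_F: "mp_regular F"
  by (rule mp_regular_leading_coeff[of "mp_degree F"])
    (use monic mp_coeff_eq_0 in \<open>auto simp: mp_monic_def\<close>)

lemma R_eq:
  assumes "poly (det Fe) w \<noteq> 0"
  shows "R w = - (mp_eval Fo w ** matrix_inv (mp_eval Fe w))"
  by (rule rm_eval_assoc_rational(2)[OF assms])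

lemma R_Fe:
  assumes "poly (det Fe) w \<noteq> 0"
  shows "R w *v (mp_eval Fe w *v x) = - (mp_eval Fo w *v x)"
proof -
  have "det (mp_eval Fe w) \<noteq> 0" using assms by (simp add: det_mp_eval)
  then show ?thesis
    unfolding R_eq[OF assms] by (simp add: matrix_vec_minus det_nz_inv_vec flip: matrix_vector_mul_assoc)
qed

lemma R_ctranspose:
  assumes "poly (det Fe) w \<noteq> 0"
  shows "R w = ctranspose (R (cnj w))"
  using self_adj rm_eval_assoc_rational(1)[OF assms] unfolding self_adjoint_rm_def by blast

text \<open>Where \<open>Fe(w)\<close> is invertible, \<open>Fo(w) = - R(w) Fe(w)\<close> with
  Hermitian \<open>R(w)\<close>. The zeros of \<open>det Fe\<close> are isolated and both sides are
  continuous, so the identity extends to them; it is later used exactly at such zeros.\<close>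

lemma Fe_Fo_symmetric:
  assumes "Im w = 0"
  shows "cinner (mp_eval Fe w *v a) (mp_eval Fo w *v b) = cinner (mp_eval Fo w *v a) (mp_eval Fe w *v b)"
proof -
  define h where "h = (\<lambda>t::real. cinner (mp_eval Fe (of_real t) *v a) (mp_eval Fo (of_real t) *v b)
      - cinner (mp_eval Fo (of_real t) *v a) (mp_eval Fe (of_real t) *v b))"
  define t0 where "t0 = Re w"
  have w: "w = of_real t0" using assms by (simp add: t0_def complex_eq_iff)
  have "h t = 0" if nz: "poly (det Fe) (of_real t) \<noteq> 0" for t
  proof -
    define X where "X = R (of_real t)"
    have X: "ctranspose X = X" using R_ctranspose[OF nz] by (simp add: X_def)
    have Fo: "mp_eval Fo (of_real t) *v x = - (X *v (mp_eval Fe (of_real t) *v x))" for x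
      unfolding X_def R_Fe[OF nz] by simp
    have "cinner u (X *v v) = cinner (X *v u) v" for u v
      unfolding cinner_ctranspose[of u X v] X ..
    then show ?thesis unfolding h_def Fo by (simp add: cinner_def sum_negf)
  qed
  then have "\<forall>\<^sub>F t in at t0. h t = 0"
    using regular_Fe unfolding mp_regular_def by (rule eventually_mono[OF eventually_of_real_poly_nz, rotated])
  then have "(h \<longlongrightarrow> 0) (at t0)" by (rule tendsto_eventually)
  moreover have "(h \<longlongrightarrow> h t0) (at t0)"
    unfolding h_def by (intro tendsto_diff tendsto_cinner tendsto_matrix_vec tendsto_mp_eval tendsto_const tendsto_of_real tendsto_ident_at)
  ultimately have "h t0 = 0" using tendsto_unique[OF at_neq_bot] by blast
  then show ?thesis unfolding h_def w by simp
qed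

text \<open>Only a limit \<open>L\<close> with nonpositive quadratic form is assumed, so that one
  argument serves both parities of the degree.\<close>

lemma hurwitz_stable_if:
  assumes hn: "herglotz_nevanlinna (assoc_rational Fe Fo)"
    and coprime: "right_coprime Fe Fo"
    and neg: "\<And>z. z \<in> mp_zeros Fe \<Longrightarrow> z \<in> \<real> \<and> Re z < 0"
    and L: "(R \<longlongrightarrow> L) at_infinity" "\<And>y. Re (cinner y (L *v y)) \<le> 0"
  shows "hurwitz_stable F"
  unfolding hurwitz_stable_def
proof (intro conjI ballI regular_F)
  fix z assume "z \<in> mp_zeros F"
  then obtain x where x: "x \<noteq> 0" "mp_eval F z *v x = 0"
    unfolding mp_zeros_def det_zero_iff_kernel by blast
  define w where "w = z\<^sup>2"
  define e where "e = mp_eval Fe w *v x"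
  define v where "v = mp_eval Fo w *v x"
  have ev: "e = - (z *s v)"
    using x(2) unfolding F_vec e_def v_def w_def by (simp add: eq_neg_iff_add_eq_0)
  have nzFe: "poly (det Fe) t \<noteq> 0" if "\<not> (Im t = 0 \<and> Re t < 0)" for t
    using neg[of t] that by (auto simp: mp_zeros_iff complex_is_Real_iff)
  show "Re z < 0"
  proof (rule ccontr)
    assume "\<not> Re z < 0"
    then consider "Re z = 0" | "Re z > 0" by linarith
    then show False
    proof cases
      case 1
      \<comment> \<open>On the imaginary axis \<open>w\<close> is real. Inserting
        \<open>e = - z v\<close> into the symmetry relation gives \<open>2 z |v|^2 = 0\<close>;
        \<open>z = 0\<close> contradicts the position of the zeros of \<open>Fe\<close>, and
        \<open>v = 0\<close> contradicts coprimeness.\<close>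
      have "Im w = 0" unfolding w_def using 1 by (simp add: power2_eq_square)
      then have "cinner e v = cinner v e"
        unfolding e_def v_def by (rule Fe_Fo_symmetric)
      then have "cnj z * cinner v v = z * cinner v v"
        unfolding ev by (simp add: cinner_diff(1)[of v 0, simplified] cinner_diff(2)[of 0, simplified] cinner_scale)
      moreover have "cnj z = - z" using 1 by (simp add: complex_eq_iff)
      ultimately have "z = 0 \<or> v = 0" by (auto simp: cinner_self)
      then show False
      proof
        assume "z = 0"
        then have "mp_eval Fe 0 *v x = 0" using ev by (simp add: e_def w_def)
        then have "det (mp_eval Fe 0) = 0" using x(1) unfolding det_zero_iff_kernel by blast
        then show False using nzFe[of 0] by (simp add: det_mp_eval)
      next
        assume "v = 0"
        then have "e = 0" using ev by simp
        then show False
          using right_coprime_kernel[OF regular_Fe coprime, of w x] \<open>v = 0\<close> x(1) by (simp add: e_def v_def)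
      qed
    next
      case 2
      have nw: "\<not> (Im w = 0 \<and> Re w < 0)"
      proof
        assume a: "Im w = 0 \<and> Re w < 0"
        have "Im w = 2 * (Re z * Im z)" by (simp add: w_def power2_eq_square)
        then have "Im z = 0" using a 2 by simp
        then show False using a by (simp add: w_def power2_eq_square not_less)
      qed
      note nz = nzFe[OF nw]
      have e0: "e \<noteq> 0"
      proof
        assume "e = 0"
        then have "det (mp_eval Fe w) = 0" using x(1) unfolding det_zero_iff_kernel e_def by blast
        then show False using nz by (simp add: det_mp_eval)
      qed
      \<comment> \<open>From \<open>z R(w) e = e\<close> it follows that \<open>q w\<close> is a
        positive multiple of \<open>cnj z\<close>. Since \<open>Im w\<close> has the sign of
        \<open>Im z\<close>, off the real axis \<open>Im (q w)\<close> has the wrong sign for a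
        Herglotz-Nevanlinna function.\<close>
      define q where "q = (\<lambda>t. cinner e (R t *v e))"
      have "R w *v e = - v" unfolding e_def v_def by (rule R_Fe[OF nz])
      then have "z *s (R w *v e) = e" by (simp add: ev vec_eq_iff)
      then have "z * q w = of_real ((norm e)\<^sup>2)"
        unfolding q_def cinner_self[symmetric] cinner_scale[symmetric] by simp
      moreover have "z \<noteq> 0" using 2 by auto
      ultimately have "q w = of_real ((norm e)\<^sup>2) / z" by (simp add: nonzero_eq_divide_eq mult.commute)
      then have "q w = of_real ((norm e)\<^sup>2) * cnj z / of_real ((cmod z)\<^sup>2)"
        by (subst (asm) complex_div_cnj) simp
      then have qw: "Im (q w) = - (((norm e)\<^sup>2 / (cmod z)\<^sup>2) * Im z)" "Re (q w) = ((norm e)\<^sup>2 / (cmod z)\<^sup>2) * Re z"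
        by (simp_all del: of_real_power)
      have c: "(norm e)\<^sup>2 / (cmod z)\<^sup>2 > 0" using e0 \<open>z \<noteq> 0\<close> by simp
      have up: "Im (q t) \<ge> 0" if "Im t > 0" for t
        using hn that unfolding herglotz_nevanlinna_def nonneg_definite_imaginary_part q_def by blast
      have cnjq: "q t = cnj (q (cnj t))" if "poly (det Fe) t \<noteq> 0" for t
        unfolding q_def R_ctranspose[OF that] cinner_ctranspose[of _ "ctranspose _"] by (simp add: cnj_cinner)
      have Imw: "Im w = 2 * Re z * Im z" by (simp add: w_def power2_eq_square)
      consider "Im z > 0" | "Im z < 0" | "Im z = 0" by linarith
      then show False
      proof cases
        case 1
        then have "Im (q w) \<ge> 0" using 2 Imw by (intro up) simp
        moreover have "Im (q w) < 0" unfolding qw using mult_pos_pos[OF c 1] by linarith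
        ultimately show False by simp
      next
        assume i: "Im z < 0"
        then have "Im (q (cnj w)) \<ge> 0" using 2 Imw by (intro up) (simp add: mult_pos_neg)
        then have "Im (q w) \<le> 0" using cnjq[OF nz] by (metis complex_cnj cnj.sel(2) neg_0_le_iff_le minus_minus)
        moreover have "Im (q w) > 0" unfolding qw using mult_pos_neg[OF c i] by linarith
        ultimately show False by simp
      next
        assume i: "Im z = 0"
        \<comment> \<open>For real \<open>z\<close> imaginary parts say nothing. Instead
          \<open>q\<close> is real and nondecreasing on the positive axis with a limit that is at
          most 0, while \<open>q w > 0\<close>.\<close>
        define t0 where "t0 = (Re z)\<^sup>2"
        have t0: "t0 > 0" "w = of_real t0"
          using 2 i by (auto simp: t0_def w_def complex_eq_iff power2_eq_square)
        define S where "S = {t. poly (det Fe) t \<noteq> 0}"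
        have "open S" unfolding S_def
          by (rule open_Collect_neq) (auto intro!: continuous_intros)
        moreover have "q holomorphic_on S"
        proof -
          have "(\<lambda>w. - cinner e (mp_eval Fo w *v (matrix_inv (mp_eval Fe w) *v e))) holomorphic_on S"
            by (intro holomorphic_on_minus holomorphic_mp_quotient holomorphic_on_ident) (simp add: S_def)
          then show ?thesis
          proof (rule holomorphic_transform)
            fix t assume "t \<in> S"
            then have "R t = - (mp_eval Fo t ** matrix_inv (mp_eval Fe t))" by (intro R_eq) (simp add: S_def)
            then show "- cinner e (mp_eval Fo t *v (matrix_inv (mp_eval Fe t) *v e)) = q t"
              by (simp add: q_def matrix_vec_minus matrix_vector_mul_assoc cinner_def sum_negf)
          qed
        qed
        moreover have "of_real t \<in> S" if "0 < t" for t :: real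
          unfolding S_def using nzFe[of "of_real t"] that by simp
        moreover have "Im (q (of_real t)) = 0" if "0 < t" for t :: real
          using cnjq[of "of_real t"] nzFe[of "of_real t"] that by (simp add: complex_eq_iff)
        ultimately have mono: "Re (q w) \<le> Re (q (of_real t))" if "t0 \<le> t" for t
          unfolding t0(2) using up t0(1) that by (intro real_part_mono_on_axis) auto
        have "((\<lambda>t::real. R (of_real t)) \<longlongrightarrow> L) at_top"
          by (rule filterlim_compose[OF L(1)]) (rule filterlim_of_real_at_infinity)
        then have "((\<lambda>t::real. Re (q (of_real t))) \<longlongrightarrow> Re (cinner e (L *v e))) at_top"
          unfolding q_def by (intro tendsto_Re tendsto_cinner tendsto_matrix_vec tendsto_const)
        then have "Re (q w) \<le> Re (cinner e (L *v e))"
          by (rule tendsto_lowerbound) (auto intro: eventually_mono[OF eventually_ge_at_top[of t0]] mono)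
        also have "\<dots> \<le> 0" by (rule L(2))
        finally show False unfolding qw using mult_pos_pos[OF c 2] by linarith
      qed
    qed
  qed
qed

end

section \<open>Reflection \<open>z\<close> to \<open>-z\<close> and the second coefficient
  \<open>A\<close>\<close>

context self_adjoint_parts
begin

abbreviation "n \<equiv> mp_degree F"

abbreviation "A \<equiv> mp_coeff F (n - 1)"

text \<open>For \<open>\<sigma> = 1\<close> and \<open>\<sigma> = -1\<close> this is \<open>2 F\<^sub>e(z\<^sup>2)\<close> and \<open>2 z F\<^sub>o(z\<^sup>2)\<close>, respectively.\<close>

definition K :: "complex \<Rightarrow> 'p matpoly" where
  "K \<sigma> = F + map_matrix (\<lambda>q. smult \<sigma> q) (mp_reflect F)"

lemma K_vec: "mp_eval (K \<sigma>) z *v x = mp_eval F z *v x + \<sigma> *s (mp_eval F (- z) *v x)"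
proof -
  have "mp_eval (K \<sigma>) z $ i $ j = mp_eval F z $ i $ j + \<sigma> * mp_eval (mp_reflect F) z $ i $ j" for i j
    by (simp add: K_def)
  then show ?thesis
    unfolding mp_eval_reflect
    by (simp add: vec_eq_iff matrix_vector_mult_def sum.distrib[symmetric] sum_distrib_left algebra_simps del: mp_eval_nth)
qed

lemma K_1: "mp_eval (K 1) z *v x = 2 *s (mp_eval Fe (z\<^sup>2) *v x)"
  unfolding K_vec F_vec F_neg_vec by (simp add: vec_eq_iff)

lemma mp_coeff_F_gt: "k > n \<Longrightarrow> mp_coeff F k = 0"
  by (rule mp_coeff_eq_0)

lemma mp_coeff_F_n: "mp_coeff F n = mat 1"
  using monic by (simp add: mp_monic_def)

text \<open>Here \<open>z\<^sup>2\<close> is real, so \<open>cinner e v\<close> is real and,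
  \<open>z\<close> being imaginary, the cross terms in \<open>|e + z v|^2\<close> and
  \<open>|e - z v|^2\<close> vanish.\<close>

lemma norm_F_imaginary:
  assumes "Re z = 0"
  shows "norm (mp_eval F (- z) *v x) = norm (mp_eval F z *v x)"
proof -
  define e where "e = mp_eval Fe (z\<^sup>2) *v x"
  define v where "v = mp_eval Fo (z\<^sup>2) *v x"
  have "Im (z\<^sup>2) = 0" using assms by (simp add: power2_eq_square)
  then have "cinner e v = cinner v e" unfolding e_def v_def by (rule Fe_Fo_symmetric)
  then have "Im (cinner e v) = 0" using cnj_cinner[of e v] by (metis Reals_cnj_iff complex_is_Real_iff)
  then have c: "Re (cinner e (z *s v)) = 0" using assms by (simp add: cinner_scale)
  have c': "cinner e ((- z) *s v) = - cinner e (z *s v)" unfolding cinner_scale by simp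
  have "(norm (e - z *s v))\<^sup>2 = (norm (e + (- z) *s v))\<^sup>2" by (simp add: vec_eq_iff arg_cong[of _ _ norm])
  also have "\<dots> = (norm (e + z *s v))\<^sup>2"
    unfolding norm_add_sq norm_scale c' using c by simp
  finally have "norm (e - z *s v) = norm (e + z *s v)" by simp
  then show ?thesis unfolding F_neg_vec unfolding F_vec e_def v_def .
qed

lemma coeffs_even:
  assumes "n = 2 * m"
  shows "mp_coeff Fe m = mat 1" "k > m \<Longrightarrow> mp_coeff Fe k = 0"
    "mp_coeff Fo (m - 1) = A" "k > m - 1 \<Longrightarrow> mp_coeff Fo k = 0"
  using assms deg mp_coeff_F_n mp_coeff_F_gt
  by (auto simp: even_odd_parts_coeff[OF parts] algebra_simps intro!: arg_cong[of _ _ "mp_coeff F"])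

lemma coeffs_odd:
  assumes "n = 2 * m + 1"
  shows "mp_coeff Fe m = A" "k > m \<Longrightarrow> mp_coeff Fe k = 0"
    "mp_coeff Fo m = mat 1" "k > m \<Longrightarrow> mp_coeff Fo k = 0"
  using assms mp_coeff_F_n mp_coeff_F_gt by (auto simp: even_odd_parts_coeff[OF parts])

text \<open>\<open>Fe_Fo_symmetric\<close> is divided by powers of a real \<open>t\<close>, which
  leave either argument of \<open>cinner\<close> unchanged, and \<open>t\<close> tends to
  infinity.\<close>

lemma leading_coeffs_symmetric:
  assumes Fe: "\<And>k. k > l \<Longrightarrow> mp_coeff Fe k = 0" and Fo: "\<And>k. k > m \<Longrightarrow> mp_coeff Fo k = 0"
  shows "cinner (mp_coeff Fe l *v a) (mp_coeff Fo m *v b) = cinner (mp_coeff Fo m *v a) (mp_coeff Fe l *v b)"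
proof -
  define E where "E = (\<lambda>t::real. mdiv (of_real t ^ l) (mp_eval Fe (of_real t)))"
  define D where "D = (\<lambda>t::real. mdiv (of_real t ^ m) (mp_eval Fo (of_real t)))"
  have E: "(E \<longlongrightarrow> mp_coeff Fe l) at_top"
    unfolding E_def by (rule filterlim_compose[OF mp_eval_mdiv_tendsto[OF Fe] filterlim_of_real_at_infinity])
  have D: "(D \<longlongrightarrow> mp_coeff Fo m) at_top"
    unfolding D_def by (rule filterlim_compose[OF mp_eval_mdiv_tendsto[OF Fo] filterlim_of_real_at_infinity])
  have "cinner (E t *v a) (D t *v b) = cinner (D t *v a) (E t *v b)" for t
    using Fe_Fo_symmetric[of "of_real t" a b] unfolding E_def D_def mdiv_mult_vec cinner_scale by simp
  moreover have "((\<lambda>t. cinner (E t *v a) (D t *v b)) \<longlongrightarrow> cinner (mp_coeff Fe l *v a) (mp_coeff Fo m *v b)) at_top"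
    by (intro tendsto_cinner tendsto_matrix_vec E D tendsto_const)
  moreover have "((\<lambda>t. cinner (D t *v a) (E t *v b)) \<longlongrightarrow> cinner (mp_coeff Fo m *v a) (mp_coeff Fe l *v b)) at_top"
    by (intro tendsto_cinner tendsto_matrix_vec E D tendsto_const)
  ultimately show ?thesis using tendsto_unique[OF trivial_limit_at_top_linorder] by simp
qed

text \<open>In both parities one of the leading coefficients of \<open>Fe\<close> and
  \<open>Fo\<close> is the identity and the other one is \<open>A\<close>.\<close>

lemma A_symmetric: "cinner a (A *v b) = cinner (A *v a) b"
proof (cases "even n")
  case True
  then obtain m where m: "n = 2 * m" by (auto elim: evenE)
  show ?thesis
    using leading_coeffs_symmetric[of m "m - 1" a b, OF coeffs_even(2,4)[OF m]]
    by (simp only: coeffs_even(1,3)[OF m] matrix_vector_mul_lid)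
next
  case False
  then obtain m where m: "n = 2 * m + 1" by (auto elim: oddE)
  show ?thesis
    using leading_coeffs_symmetric[of m m a b, OF coeffs_odd(2,4)[OF m]]
    by (simp only: coeffs_odd(1,3)[OF m] matrix_vector_mul_lid)
qed

section \<open>Consequences of stability: contractivity and the functions \<open>f\<close>\<close>

context
  assumes stable: "hurwitz_stable F"
begin

lemma det_F_nz: "Re z \<ge> 0 \<Longrightarrow> poly (det F) z \<noteq> 0"
  using stable unfolding hurwitz_stable_def mp_zeros_iff[symmetric] by force

lemma det_eval_F_nz: "Re z \<ge> 0 \<Longrightarrow> det (mp_eval F z) \<noteq> 0"
  by (simp add: det_mp_eval det_F_nz)

lemma F_vec_eq_0: "Re z \<ge> 0 \<Longrightarrow> mp_eval F z *v x = 0 \<Longrightarrow> x = 0"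
  using det_eval_F_nz det_zero_iff_kernel by blast

definition X where "X z v = matrix_inv (mp_eval F z) *v v"

lemma F_X: "Re z \<ge> 0 \<Longrightarrow> mp_eval F z *v X z v = v"
  unfolding X_def by (rule det_nz_inv_vec(1)[OF det_eval_F_nz])

lemma X_F: "Re z \<ge> 0 \<Longrightarrow> X z (mp_eval F z *v x) = x"
  unfolding X_def by (rule det_nz_inv_vec(2)[OF det_eval_F_nz])

text \<open>The maximum modulus principle is applied to the scalar function \<open>g\<close>, with
  \<open>u\<close> and \<open>v\<close> frozen at the given \<open>z\<close> and \<open>x\<close>.
  At \<open>w = z\<close> it equals \<open>|u|^2\<close>, and the bound \<open>|u| |v|\<close> gives
  the claim after cancelling \<open>|u|\<close>.\<close>

lemma norm_F_right_half_plane: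
  assumes z: "Re z \<ge> 0"
  shows "norm (mp_eval F (- z) *v x) \<le> norm (mp_eval F z *v x)"
proof -
  define v where "v = mp_eval F z *v x"
  define u where "u = mp_eval F (- z) *v x"
  define g where "g = (\<lambda>w. cinner u (mp_eval (mp_reflect F) w *v (matrix_inv (mp_eval F w) *v v)))"
  have g: "g w = cinner u (mp_eval F (- w) *v X w v)" for w
    by (simp add: g_def mp_eval_reflect X_def)
  have "cmod (g z) \<le> norm u * norm v"
  proof (rule maximum_modulus_half_plane[OF _ _ _ _ z])
    show "g holomorphic_on {z. 0 < Re z}"
      unfolding g_def by (intro holomorphic_mp_quotient holomorphic_on_ident det_F_nz) simp
    have "open {w. poly (det F) w \<noteq> 0}" by (rule open_Collect_neq) (auto intro!: continuous_intros)
    moreover have "g holomorphic_on {w. poly (det F) w \<noteq> 0}"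
      unfolding g_def by (intro holomorphic_mp_quotient holomorphic_on_ident) simp
    ultimately show "continuous_on {z. 0 \<le> Re z} g"
      by (intro continuous_on_subset[OF holomorphic_on_imp_continuous_on]) (auto simp: det_F_nz)
    show "cmod (g w) \<le> norm u * norm v" if "Re w = 0" for w
    proof -
      have "cmod (g w) \<le> norm u * norm (mp_eval F (- w) *v X w v)" unfolding g by (rule cmod_cinner_le)
      also have "norm (mp_eval F (- w) *v X w v) = norm v"
        unfolding norm_F_imaginary[OF that] using F_X[of w v] that by simp
      finally show ?thesis .
    qed
    show "\<exists>\<rho>. \<forall>w. 0 \<le> Re w \<longrightarrow> \<rho> \<le> cmod w \<longrightarrow> cmod (g w) \<le> norm u * norm v + e" if e: "e > 0" for e
    proof -
      \<comment> \<open>As \<open>F\<close> is monic, \<open>F(-w) F(w)^-1\<close> tends to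
        \<open>(- 1) ^ n\<close> times the identity, which is an isometry.\<close>
      define \<sigma> :: complex where "\<sigma> = (- 1) ^ n"
      define L where "L = mp_coeff (mp_reflect F) n"
      have "((\<lambda>w. mp_eval (mp_reflect F) w ** matrix_inv (mp_eval F w)) \<longlongrightarrow> L ** matrix_inv (mp_coeff F n)) at_infinity"
        unfolding L_def
      proof (rule tendsto_matrix_quotient[OF mp_eval_mdiv_tendsto mp_eval_mdiv_tendsto])
        show "mp_coeff (mp_reflect F) k = 0" if "n < k" for k
          using mp_coeff_F_gt[OF that] unfolding vec_eq_iff mp_coeff_reflect by simp
      qed (auto simp: mp_coeff_F_gt mp_coeff_F_n)
      then have "(g \<longlongrightarrow> cinner u ((L ** matrix_inv (mp_coeff F n)) *v v)) at_infinity"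
        unfolding g_def matrix_vector_mul_assoc by (intro tendsto_cinner tendsto_matrix_vec tendsto_const)
      also have "matrix_inv (mp_coeff F n) = mat 1"
        unfolding mp_coeff_F_n using det_nz_inv(1)[of "mat 1 :: complex ^ 'p ^ 'p"] by simp
      also have "(L ** mat 1) *v v = \<sigma> *s v"
      proof -
        have "L = (\<chi> i j. \<sigma> * mat 1 $ i $ j)"
          unfolding vec_eq_iff L_def mp_coeff_reflect mp_coeff_F_n by (simp add: \<sigma>_def)
        then have "L *v v = \<sigma> *s (mat 1 *v v)"
          by (simp add: vec_eq_iff matrix_vector_mult_def sum_distrib_left mult.assoc)
        then show ?thesis by simp
      qed
      finally have "(g \<longlongrightarrow> cinner u (\<sigma> *s v)) at_infinity" .
      then have "\<forall>\<^sub>F w in at_infinity. dist (g w) (cinner u (\<sigma> *s v)) < e" using e by (rule tendstoD)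
      then obtain \<rho> where \<rho>: "\<And>w. \<rho> \<le> cmod w \<Longrightarrow> dist (g w) (cinner u (\<sigma> *s v)) < e"
        unfolding eventually_at_infinity by blast
      have "cmod (cinner u (\<sigma> *s v)) \<le> norm u * norm v"
        using cmod_cinner_le[of u v] by (simp add: cinner_scale norm_mult \<sigma>_def norm_power)
      then have "cmod (g w) \<le> norm u * norm v + e" if "\<rho> \<le> cmod w" for w
        using \<rho>[OF that] norm_triangle_sub[of "g w" "cinner u (\<sigma> *s v)"] by (simp add: dist_norm)
      then show ?thesis by blast
    qed
  qed
  moreover have "g z = cinner u u" unfolding g v_def X_F[OF z] by (simp add: u_def)
  ultimately have "norm u * norm u \<le> norm u * norm v"
    by (simp add: cinner_self power2_eq_square norm_mult)
  then show ?thesis unfolding u_def[symmetric] v_def[symmetric] by (cases "norm u = 0") auto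
qed

text \<open>The scalar functions formed from \<open>v\<close> and
  \<open>I + \<sigma> \<Theta>(z)\<close>, with \<open>\<Theta>(z) = F(-z) F(z)^-1\<close>.\<close>

definition f where "f \<sigma> v z = cinner v (mp_eval (K \<sigma>) z *v X z v)"

lemma f_eq: "Re z \<ge> 0 \<Longrightarrow> f \<sigma> v z = cinner v (v + \<sigma> *s (mp_eval F (- z) *v X z v))"
  unfolding f_def K_vec F_X ..

lemma f_holomorphic: "f \<sigma> v holomorphic_on {z. Re z > 0}"
  unfolding f_def[abs_def] X_def
  by (intro holomorphic_mp_quotient holomorphic_on_ident det_F_nz) simp

lemma norm_F_neg_X: "Re z \<ge> 0 \<Longrightarrow> norm (mp_eval F (- z) *v X z v) \<le> norm v"
  using norm_F_right_half_plane[of z "X z v"] by (simp add: F_X)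

lemma f_nonneg:
  assumes "cmod \<sigma> = 1" "Re z \<ge> 0"
  shows "Re (f \<sigma> v z) \<ge> 0"
proof -
  define t where "t = \<sigma> *s (mp_eval F (- z) *v X z v)"
  have "norm t \<le> norm v" unfolding t_def norm_scale using norm_F_neg_X assms by simp
  then have "cmod (cinner v t) \<le> norm v * norm v"
    using cmod_cinner_le[of v t] by (meson mult_left_mono norm_ge_zero order_trans)
  then have "- Re (cinner v t) \<le> norm v * norm v" using abs_Re_le_cmod[of "cinner v t"] by linarith
  then show ?thesis unfolding f_eq[OF assms(2)] t_def[symmetric] cinner_add cinner_self
    by (simp add: power2_eq_square)
qed

text \<open>Contractivity puts \<open>norm_add_eq_0\<close> in force: the vanishing of one scalar
  product forces the whole vector to vanish.\<close>

lemma f_eq_0_imp: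
  assumes "cmod \<sigma> = 1" "Re z \<ge> 0" "f \<sigma> v z = 0"
  shows "mp_eval (K \<sigma>) z *v X z v = 0"
proof -
  have "v + \<sigma> *s (mp_eval F (- z) *v X z v) = 0"
    using assms norm_F_neg_X by (intro norm_add_eq_0) (simp_all add: f_eq norm_scale)
  then show ?thesis unfolding K_vec F_X[OF assms(2)] .
qed

lemma f_Harnack:
  assumes "cmod \<sigma> = 1" "Re r > 0" "Re s > 0"
  shows "Re s * Re r * cmod (f \<sigma> v r) \<le> (cmod (s + cnj r))\<^sup>2 * cmod (f \<sigma> v s)"
  by (rule Harnack_half_plane[OF f_holomorphic]) (use f_nonneg assms in auto)

text \<open>Otherwise \<open>Fe(r)\<close> annihilates \<open>X z v\<close> with
  \<open>z = sqrt r\<close> for every \<open>r > 0\<close>; then \<open>det Fe\<close> vanishes on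
  the positive axis, against regularity.\<close>

lemma f_1_nontrivial:
  assumes "\<And>z. Re z > 0 \<Longrightarrow> f 1 v z = 0"
  shows "v = 0"
proof (rule ccontr)
  assume v: "v \<noteq> 0"
  have "poly (det Fe) (of_real r) = 0" if r: "r > 0" for r :: real
  proof -
    define z where "z = complex_of_real (sqrt r)"
    have z: "Re z > 0" "z\<^sup>2 = of_real r" using r by (simp_all add: z_def flip: of_real_power)
    have "mp_eval (K 1) z *v X z v = 0" using z assms by (intro f_eq_0_imp) auto
    then have "mp_eval Fe (of_real r) *v X z v = 0" unfolding K_1 z(2) by (simp add: vec_eq_iff)
    moreover have "X z v \<noteq> 0" using F_X[of z v] z v by auto
    ultimately have "det (mp_eval Fe (of_real r)) = 0" unfolding det_zero_iff_kernel by blast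
    then show ?thesis by (simp add: det_mp_eval)
  qed
  then have "det Fe = 0" by (intro poly_eqI_positive_reals) simp
  then show False using regular_Fe by (simp add: mp_regular_def)
qed

text \<open>\<open>x(z) = F(z)\<^sup>-\<^sup>1 v\<close> is an even rational function whose poles lie in the left half-plane,
  hence a polynomial; it vanishes at infinity.\<close>

lemma f_minus_1_nontrivial:
  assumes "\<And>z. Re z > 0 \<Longrightarrow> f (- 1) v z = 0"
  shows "v = 0"
proof -
  define d where "d = det F"
  have d0: "d \<noteq> 0" using regular_F by (simp add: d_def mp_regular_def)
  obtain P where P: "\<And>z k. poly d z \<noteq> 0 \<Longrightarrow> X z v $ k = poly (P k) z / poly d z"
    unfolding d_def X_def using mp_inv_vec_rational[of F v] by blast
  have X_eq: "poly d z *s X z v = (\<chi> k. poly (P k) z)" if "Re z \<ge> 0" for z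
    using P[of z] det_F_nz[OF that] by (simp add: d_def vec_eq_iff)
  \<comment> \<open>The relations \<open>F(z) x(z) = v\<close> and, below,
    \<open>F(-z) x(z) = v\<close> are multiplied by \<open>d\<close> and become polynomial
    identities, so that they hold in the left half-plane too.\<close>
  have 1: "(\<Sum>j\<in>UNIV. F $ i $ j * P j) = smult (v $ i) d" for i
  proof (rule poly_eqI_positive_reals)
    fix r :: real assume r: "r > 0"
    define z where "z = complex_of_real r"
    have z: "Re z \<ge> 0" using r by (simp add: z_def)
    have "mp_eval F z *v (\<chi> k. poly (P k) z) = poly d z *s v"
      unfolding X_eq[OF z, symmetric] vector_scalar_commute F_X[OF z] ..
    from arg_cong[OF this, of "\<lambda>v. v $ i"]
    show "poly (\<Sum>j\<in>UNIV. F $ i $ j * P j) (of_real r) = poly (smult (v $ i) d) (of_real r)"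
      by (simp add: matrix_vector_mult_def poly_sum z_def mult.commute)
  qed
  have 2: "(\<Sum>j\<in>UNIV. mp_reflect F $ i $ j * P j) = smult (v $ i) d" for i
  proof (rule poly_eqI_positive_reals)
    fix r :: real assume r: "r > 0"
    define z where "z = complex_of_real r"
    have z: "Re z \<ge> 0" "Re z > 0" using r by (simp_all add: z_def)
    have "mp_eval (K (- 1)) z *v X z v = 0" using z assms by (intro f_eq_0_imp) auto
    then have "mp_eval F (- z) *v X z v = v" unfolding K_vec F_X[OF z(1)] by (simp add: vec_eq_iff)
    then have "mp_eval (mp_reflect F) z *v (\<chi> k. poly (P k) z) = poly d z *s v"
      unfolding X_eq[OF z(1), symmetric] vector_scalar_commute mp_eval_reflect by simp
    from arg_cong[OF this, of "\<lambda>v. v $ i"]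
    show "poly (\<Sum>j\<in>UNIV. mp_reflect F $ i $ j * P j) (of_real r) = poly (smult (v $ i) d) (of_real r)"
      by (simp add: matrix_vector_mult_def poly_sum z_def mult.commute)
  qed
  define \<rho> where "\<rho> = (\<lambda>q :: complex poly. pcompose q [:0, - 1:])"
  have poly_\<rho>: "poly (\<rho> q) z = poly q (- z)" for q z by (simp add: \<rho>_def poly_pcompose)
  have PF: "mp_eval F z *v (\<chi> k. poly (P k) z) = poly d z *s v" for z
    using arg_cong[OF 1, of "\<lambda>q. poly q z"] by (simp add: vec_eq_iff matrix_vector_mult_def poly_sum mult.commute)
  have PF': "mp_eval F z *v (\<chi> k. poly (P k) (- z)) = poly d (- z) *s v" for z
    using arg_cong[OF 2, of "\<lambda>q. poly q (- z)"]
    by (simp add: vec_eq_iff matrix_vector_mult_def poly_sum mult.commute mp_reflect_def poly_pcompose)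
  \<comment> \<open>Evenness of \<open>x = P / d\<close>, cross-multiplied.\<close>
  have sym: "\<rho> (P k) * d = P k * \<rho> d" for k
  proof (rule poly_eqI_positive_reals)
    fix r :: real assume r: "r > 0"
    define z where "z = complex_of_real r"
    have z: "Re z \<ge> 0" using r by (simp add: z_def)
    have "mp_eval F z *v (poly d z *s (\<chi> k. poly (P k) (- z)) - poly d (- z) *s (\<chi> k. poly (P k) z)) = 0"
      unfolding matrix_vector_mult_diff_distrib vector_scalar_commute PF PF'
      by (simp add: vec_eq_iff)
    then have "poly d z *s (\<chi> k. poly (P k) (- z)) - poly d (- z) *s (\<chi> k. poly (P k) z) = 0"
      by (rule F_vec_eq_0[OF z])
    then have "poly d z * poly (P k) (- z) = poly d (- z) * poly (P k) z"
      by (simp add: vec_eq_iff)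
    then show "poly (\<rho> (P k) * d) (of_real r) = poly (P k * \<rho> d) (of_real r)"
      by (simp add: poly_\<rho> z_def mult.commute)
  qed
  \<comment> \<open>The roots of \<open>d\<close> have negative and those of \<open>\<rho> d\<close>
    positive real part, so there is no common root.\<close>
  have "coprime d (\<rho> d)"
  proof (rule ccontr)
    assume "\<not> coprime d (\<rho> d)"
    then have "\<not> is_unit (gcd d (\<rho> d))" by (simp only: is_unit_gcd not_False_eq_True)
    moreover have "gcd d (\<rho> d) \<noteq> 0" using d0 by simp
    ultimately have "degree (gcd d (\<rho> d)) \<noteq> 0" using is_unit_iff_degree by blast
    then obtain z where "poly (gcd d (\<rho> d)) z = 0"
      using alg_closed_imp_poly_has_root[of "gcd d (\<rho> d)"] by auto
    then have z: "[:- z, 1:] dvd gcd d (\<rho> d)" by (simp add: poly_eq_0_iff_dvd)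
    have "poly d z = 0" "poly (\<rho> d) z = 0"
      using dvd_trans[OF z gcd_dvd1] dvd_trans[OF z gcd_dvd2] by (simp_all add: poly_eq_0_iff_dvd)
    then have "\<not> Re z \<ge> 0" "\<not> Re (- z) \<ge> 0"
      using det_F_nz[of z] det_F_nz[of "- z"] unfolding poly_\<rho> d_def by auto
    then show False by simp
  qed
  moreover have "d dvd P k * \<rho> d" for k using dvd_triv_right[of d "\<rho> (P k)"] unfolding sym .
  ultimately have "d dvd P k" for k by (simp add: coprime_dvd_mult_left_iff)
  then have "\<forall>k. \<exists>q. P k = d * q" by (auto simp: dvd_def)
  then obtain Q where Q: "\<And>k. P k = d * Q k" by metis
  have QX: "poly (Q k) z = X z v $ k" if "poly d z \<noteq> 0" for z k
    using P[OF that, of k] that by (simp add: Q)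
  have "((\<lambda>z. X z v) \<longlongrightarrow> 0) at_infinity"
  proof -
    \<comment> \<open>Since \<open>n >= 1\<close>, the constant matrix \<open>mat 1\<close> is of
      lower order than \<open>z ^ n\<close>.\<close>
    have c: "((\<lambda>z. mdiv (z ^ n) (mp_eval (mat 1) z)) \<longlongrightarrow> mp_coeff (mat 1 :: 'p matpoly) n) at_infinity"
      using deg by (intro mp_eval_mdiv_tendsto) (auto simp: vec_eq_iff mat_def)
    have "mp_coeff (mat 1 :: 'p matpoly) n = 0" using deg by (auto simp: vec_eq_iff mat_def)
    moreover have "mp_eval (mat 1 :: 'p matpoly) z = mat 1" for z by (simp add: vec_eq_iff mat_def)
    ultimately have "((\<lambda>z. mdiv (z ^ n) (mat 1 :: complex ^ 'p ^ 'p)) \<longlongrightarrow> 0) at_infinity" using c by simp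
    then have "((\<lambda>z. mat 1 ** matrix_inv (mp_eval F z)) \<longlongrightarrow> 0 ** matrix_inv (mp_coeff F n)) at_infinity"
      by (rule tendsto_matrix_quotient[OF _ mp_eval_mdiv_tendsto[OF mp_coeff_F_gt]]) (auto simp: mp_coeff_F_n)
    then have "((\<lambda>z. X z v) \<longlongrightarrow> (0 ** matrix_inv (mp_coeff F n)) *v v) at_infinity"
      unfolding X_def matrix_mul_lid by (intro tendsto_matrix_vec tendsto_const)
    then show ?thesis by simp
  qed
  then have "((\<lambda>z. X z v $ k) \<longlongrightarrow> 0) at_infinity" for k
    using tendsto_vec_nth[of "\<lambda>z. X z v" 0 at_infinity k] by simp
  moreover have "\<forall>\<^sub>F z in at_infinity. X z v $ k = poly (Q k) z" for k
    using eventually_poly_nz_at_infinity[OF d0] by eventually_elim (simp add: QX)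
  ultimately have "(poly (Q k) \<longlongrightarrow> 0) at_infinity" for k by (rule Lim_transform_eventually)
  then have "Q k = 0" for k by (rule poly_tendsto_0_at_infinity)
  then have "X 1 v = 0" using QX[of 1] det_F_nz[of 1] by (simp add: vec_eq_iff d_def)
  then show "v = 0" using F_X[of 1 v] by simp
qed

lemma f_nontrivial:
  assumes "\<sigma> = 1 \<or> \<sigma> = - 1" "\<And>z. Re z > 0 \<Longrightarrow> f \<sigma> v z = 0"
  shows "v = 0"
  using assms f_1_nontrivial f_minus_1_nontrivial by blast

text \<open>Let \<open>w = s\<^sup>2\<close> with \<open>Re s >= 0\<close>. If
  \<open>Re s > 0\<close>, then \<open>f 1 v\<close> vanishes at the interior point \<open>s\<close>
  for \<open>v = F(s) x\<close>, hence identically by Harnack, and \<open>v = 0\<close>. So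
  \<open>s\<close> is imaginary, and \<open>s = 0\<close> is excluded because
  \<open>F(0) = Fe(0)\<close>.\<close>

lemma Fe_zeros:
  assumes "w \<in> mp_zeros Fe"
  shows "Im w = 0" "Re w < 0"
proof -
  obtain x where x: "x \<noteq> 0" "mp_eval Fe w *v x = 0"
    using assms unfolding mp_zeros_def det_zero_iff_kernel by blast
  define s where "s = csqrt w"
  have w: "w = s\<^sup>2" by (simp add: s_def)
  have s: "Re s \<ge> 0" using csqrt_principal[of w] by (auto simp: s_def)
  have "Re s = 0"
  proof (rule ccontr)
    assume "Re s \<noteq> 0"
    then have s': "Re s > 0" using s by simp
    define v where "v = mp_eval F s *v x"
    have "f 1 v s = 0" unfolding f_def v_def X_F[OF s] K_1 w[symmetric] x(2) by simp
    then have "f 1 v r = 0" if "Re r > 0" for r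
      using f_Harnack[of 1 r s v] that s' by (simp add: mult_le_0_iff)
    then have "v = 0" by (rule f_1_nontrivial)
    then show False using F_vec_eq_0[OF s] x(1) by (simp add: v_def)
  qed
  moreover have "Im s \<noteq> 0"
  proof
    assume "Im s = 0"
    then have "s = 0" using \<open>Re s = 0\<close> by (simp add: complex_eq_iff)
    then have "mp_eval F 0 *v x = 0" unfolding F_vec using x(2) w by simp
    then show False using F_vec_eq_0[of 0 x] x(1) by simp
  qed
  moreover have "Re w = (Re s)\<^sup>2 - (Im s)\<^sup>2" "Im w = 2 * Re s * Im s"
    unfolding w by (simp_all add: power2_eq_square)
  ultimately show "Im w = 0" "Re w < 0" by simp_all
qed

text \<open>A kernel vector of a common divisor at \<open>w\<close> is a kernel vector of
  \<open>F\<close> at \<open>csqrt w\<close>, which lies in the closed right half-plane.\<close>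

lemma right_coprime_Fe_Fo: "right_coprime Fe Fo"
  unfolding right_coprime_def unimodular_def
proof (intro allI impI notI)
  fix G w assume "is_grcd G Fe Fo" and "det (mp_eval G w) = 0"
  then obtain C D x where CD: "Fe = C ** G" "Fo = D ** G" and x: "x \<noteq> 0" "mp_eval G w *v x = 0"
    unfolding is_grcd_def right_common_divisor_def right_divisor_def det_zero_iff_kernel by blast
  define s where "s = csqrt w"
  have s: "Re s \<ge> 0" "s\<^sup>2 = w" using csqrt_principal[of w] by (auto simp: s_def)
  have "mp_eval Fe w *v x = 0" "mp_eval Fo w *v x = 0"
    unfolding CD mp_eval_mult by (simp_all add: x(2) flip: matrix_vector_mul_assoc)
  then have "mp_eval F s *v x = 0" unfolding F_vec s(2) by simp
  then show False using F_vec_eq_0[OF s(1)] x(1) by blast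
qed

section \<open>Herglotz-Nevanlinna property, positivity of \<open>A\<close> and simplicity of
  \<open>Fe\<close>\<close>

lemma det_Fe_square_nz:
  assumes "Re s > 0"
  shows "poly (det Fe) (s\<^sup>2) \<noteq> 0"
proof
  assume "poly (det Fe) (s\<^sup>2) = 0"
  then have z: "Im (s\<^sup>2) = 0" "Re (s\<^sup>2) < 0"
    using Fe_zeros unfolding mp_zeros_iff[symmetric] by blast+
  have "Im (s\<^sup>2) = 2 * (Re s * Im s)" by (simp add: power2_eq_square)
  then have "Im s = 0" using z(1) assms by simp
  then show False using z(2) by (simp add: power2_eq_square not_less)
qed

lemma Im_R_nonneg:
  assumes "Im w > 0"
  shows "Im (cinner y (R w *v y)) \<ge> 0"
proof -
  define h where "h = (\<lambda>s. s * cinner y (mp_eval Fo (s\<^sup>2) *v (matrix_inv (mp_eval Fe (s\<^sup>2)) *v y)))"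
  define s where "s = csqrt w"
  have w: "w = s\<^sup>2" by (simp add: s_def)
  have Imw: "Im w = 2 * (Re s * Im s)" unfolding w by (simp add: power2_eq_square)
  have "Re s \<ge> 0" using csqrt_principal[of w] by (auto simp: s_def)
  then have s: "Re s > 0" "Im s > 0" using assms unfolding Imw by (auto simp: zero_less_mult_iff)
  have "\<bar>Im (h s)\<bar> * Re s \<le> Re (h s) * \<bar>Im s\<bar>"
  proof (rule Stolz_angle_half_plane[OF _ _ _ s(1)])
    show "h holomorphic_on {z. 0 < Re z}"
      unfolding h_def by (intro holomorphic_intros holomorphic_mp_quotient) (simp add: det_Fe_square_nz)
  next
    fix z assume z: "0 < Re z"
    \<comment> \<open>With \<open>Fe(z\<^sup>2) x = y\<close>, contractivity reads
      \<open>|y - u| <= |y + u|\<close>, which is \<open>Re (h z) >= 0\<close>.\<close>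
    define x where "x = matrix_inv (mp_eval Fe (z\<^sup>2)) *v y"
    have y: "mp_eval Fe (z\<^sup>2) *v x = y"
      unfolding x_def using det_Fe_square_nz[OF z] by (simp add: det_nz_inv_vec det_mp_eval)
    define u where "u = z *s (mp_eval Fo (z\<^sup>2) *v x)"
    have "norm (mp_eval F (- z) *v x) \<le> norm (mp_eval F z *v x)"
      using z by (intro norm_F_right_half_plane) simp
    then have "norm (y - u) \<le> norm (y + u)"
      unfolding F_neg_vec unfolding F_vec y u_def .
    then have "(norm (y - u))\<^sup>2 \<le> (norm (y + u))\<^sup>2" by (intro power_mono) auto
    then have "0 \<le> Re (cinner y u)"
      unfolding norm_add_sq norm_diff_sq by simp
    then show "0 \<le> Re (h z)" by (simp add: h_def u_def x_def cinner_scale)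
  next
    fix t :: real assume t: "0 < t"
    define z where "z = complex_of_real t"
    have z: "0 < Re z" "Im (z\<^sup>2) = 0" using t by (simp_all add: z_def power2_eq_square)
    define x where "x = matrix_inv (mp_eval Fe (z\<^sup>2)) *v y"
    have y: "mp_eval Fe (z\<^sup>2) *v x = y"
      unfolding x_def using det_Fe_square_nz[OF z(1)] by (simp add: det_nz_inv_vec det_mp_eval)
    have "cinner y (mp_eval Fo (z\<^sup>2) *v x) = cinner (mp_eval Fo (z\<^sup>2) *v x) y"
      using Fe_Fo_symmetric[OF z(2), of x x] unfolding y .
    then have "Im (cinner y (mp_eval Fo (z\<^sup>2) *v x)) = 0"
      using cnj_cinner[of y "mp_eval Fo (z\<^sup>2) *v x"] by (metis Reals_cnj_iff complex_is_Real_iff)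
    then show "Im (h (complex_of_real t)) = 0"
      by (simp add: h_def x_def z_def)
  qed
  moreover have "Im (h s) * Re s \<le> \<bar>Im (h s)\<bar> * Re s" using s by (intro mult_right_mono) auto
  moreover have "\<bar>Im s\<bar> = Im s" using s by simp
  ultimately have 1: "Im (h s) * Re s \<le> Re (h s) * Im s" by (metis order_trans)
  \<comment> \<open>The estimate says that \<open>h s * cnj s\<close> has nonpositive imaginary
    part, and this product is \<open>- |s|^2 q\<close>.\<close>
  define q where "q = cinner y (R w *v y)"
  have "h s = - (s * q)"
  proof -
    have "R w = - (mp_eval Fo w ** matrix_inv (mp_eval Fe w))"
      unfolding w by (rule R_eq[OF det_Fe_square_nz[OF s(1)]])
    then have "R w *v y = - (mp_eval Fo w *v (matrix_inv (mp_eval Fe w) *v y))"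
      by (simp add: matrix_vec_minus matrix_vector_mul_assoc)
    then show ?thesis by (simp add: q_def h_def w[symmetric] cinner_def sum_negf)
  qed
  then have "0 \<le> ((Re s)\<^sup>2 + (Im s)\<^sup>2) * Im q"
    using 1 by (simp add: algebra_simps power2_eq_square)
  moreover have "(Re s)\<^sup>2 + (Im s)\<^sup>2 > 0" using s by (simp add: sum_power2_gt_zero_iff)
  ultimately show ?thesis unfolding q_def[symmetric] by (simp add: zero_le_mult_iff)
qed

lemma herglotz_nevanlinna_R: "herglotz_nevanlinna (assoc_rational Fe Fo)"
  unfolding herglotz_nevanlinna_def nonneg_definite_imaginary_part
proof (intro conjI allI impI Im_R_nonneg)
  fix i j
  have nz: "poly (det Fe) z \<noteq> 0" if "Im z > 0" for z
    using that Fe_zeros(1)[of z] by (auto simp: mp_zeros_iff)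
  have "(\<lambda>z. - cinner (axis i 1) (mp_eval Fo z *v (matrix_inv (mp_eval Fe z) *v axis j 1))) holomorphic_on {z. 0 < Im z}"
    by (intro holomorphic_on_minus holomorphic_mp_quotient holomorphic_on_ident nz) simp
  then show "(\<lambda>z. R z $ i $ j) holomorphic_on {z. 0 < Im z}"
    by (rule holomorphic_transform)
      (simp add: R_eq nz cinner_axis matrix_vec_axis matrix_vector_mul_assoc)
qed

text \<open>At infinity \<open>z f(z)\<close> tends to twice the quadratic form of \<open>A\<close>.
  Were that form 0, \<open>f(t)\<close> would decay faster than \<open>1 / t\<close> along the
  positive axis, which Harnack permits only for \<open>f = 0\<close>.\<close>

lemma A_positive:
  assumes v: "v \<noteq> 0"
  shows "Re (cinner v (A *v v)) > 0"
proof (rule ccontr)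
  assume np: "\<not> Re (cinner v (A *v v)) > 0"
  \<comment> \<open>This sign cancels the coefficient of \<open>z ^ n\<close> in
    \<open>F(z) + \<sigma> F(-z)\<close> and doubles that of \<open>z ^ (n - 1)\<close>.\<close>
  define \<sigma> :: complex where "\<sigma> = - ((- 1) ^ n)"
  have \<sigma>: "cmod \<sigma> = 1" "\<sigma> = 1 \<or> \<sigma> = - 1"
    by (cases "even n"; simp add: \<sigma>_def)+
  have Kc: "mp_coeff (K \<sigma>) k $ i $ j = (1 + \<sigma> * (- 1) ^ k) * mp_coeff F k $ i $ j" for k i j
    using mp_coeff_reflect[of F k i j] by (simp add: K_def algebra_simps)
  have K0: "mp_coeff (K \<sigma>) k = 0" if "k > n - 1" for k
  proof (cases "k = n")
    case True
    then show ?thesis unfolding vec_eq_iff Kc by (simp add: \<sigma>_def flip: power_mult_distrib)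
  next
    case False
    then have "k > n" using that by simp
    then show ?thesis unfolding vec_eq_iff Kc mp_coeff_F_gt[OF \<open>k > n\<close>] by simp
  qed
  have "(- 1) ^ n = - ((- 1 :: complex) ^ (n - 1))" using deg by (cases n) simp_all
  then have Kn: "mp_coeff (K \<sigma>) (n - 1) *v v = 2 *s (A *v v)"
    unfolding vec_eq_iff matrix_vector_mult_def vec_lambda_beta Kc
    by (simp add: \<sigma>_def sum_distrib_left mult.assoc flip: power_mult_distrib)
  have lim: "((\<lambda>z. z * f \<sigma> v z) \<longlongrightarrow> 2 * cinner v (A *v v)) at_infinity"
  proof -
    \<comment> \<open>Scaling by \<open>mdiv (1 / z)\<close> is multiplication by \<open>z\<close>;
      it brings \<open>K \<sigma>\<close> and \<open>F\<close> to the common power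
      \<open>z ^ n\<close>.\<close>
    have "\<forall>\<^sub>F z in at_infinity. mdiv (z ^ (n - 1)) (mp_eval (K \<sigma>) z) = mdiv (z ^ n) (mdiv (1 / z) (mp_eval (K \<sigma>) z))"
      using eventually_not_equal_at_infinity[of 0]
    proof eventually_elim
      case (elim z)
      have "z ^ n = z * z ^ (n - 1)" using deg by (cases n) simp_all
      then show ?case using elim by (simp add: mdiv_def vec_eq_iff)
    qed
    moreover have "((\<lambda>z. mdiv (z ^ (n - 1)) (mp_eval (K \<sigma>) z)) \<longlongrightarrow> mp_coeff (K \<sigma>) (n - 1)) at_infinity"
      by (rule mp_eval_mdiv_tendsto) (rule K0)
    ultimately have "((\<lambda>z. mdiv (z ^ n) (mdiv (1 / z) (mp_eval (K \<sigma>) z))) \<longlongrightarrow> mp_coeff (K \<sigma>) (n - 1)) at_infinity"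
      by (rule Lim_transform_eventually[rotated])
    then have "((\<lambda>z. mdiv (1 / z) (mp_eval (K \<sigma>) z) ** matrix_inv (mp_eval F z))
        \<longlongrightarrow> mp_coeff (K \<sigma>) (n - 1) ** matrix_inv (mp_coeff F n)) at_infinity"
      by (rule tendsto_matrix_quotient[OF _ mp_eval_mdiv_tendsto[OF mp_coeff_F_gt]]) (auto simp: mp_coeff_F_n)
    also have "matrix_inv (mp_coeff F n) = mat 1"
      unfolding mp_coeff_F_n using det_nz_inv(1)[of "mat 1 :: complex ^ 'p ^ 'p"] by simp
    finally have "((\<lambda>z. cinner v ((mdiv (1 / z) (mp_eval (K \<sigma>) z) ** matrix_inv (mp_eval F z)) *v v))
        \<longlongrightarrow> cinner v ((mp_coeff (K \<sigma>) (n - 1) ** mat 1) *v v)) at_infinity"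
      by (intro tendsto_cinner tendsto_matrix_vec tendsto_const)
    then show ?thesis
      by (simp add: Kn cinner_scale f_def X_def mdiv_mult_vec del: One_nat_def flip: matrix_vector_mul_assoc)
  qed
  have lim': "((\<lambda>t::real. of_real t * f \<sigma> v (of_real t)) \<longlongrightarrow> 2 * cinner v (A *v v)) at_top"
    by (rule filterlim_compose[OF lim filterlim_of_real_at_infinity])
  have "0 \<le> Re (2 * cinner v (A *v v))"
  proof (rule tendsto_lowerbound[OF tendsto_Re[OF lim']])
    show "\<forall>\<^sub>F t in at_top. 0 \<le> Re (complex_of_real t * f \<sigma> v (complex_of_real t))"
      using eventually_ge_at_top[of 0] by eventually_elim (simp add: f_nonneg \<sigma>)
  qed simp
  then have "Re (cinner v (A *v v)) = 0" using np by simp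
  moreover have "Im (cinner v (A *v v)) = 0"
    using A_symmetric[of v v] cnj_cinner[of v "A *v v"] by (metis Reals_cnj_iff complex_is_Real_iff)
  ultimately have "cinner v (A *v v) = 0" by (simp add: complex_eq_iff)
  then have lim0: "((\<lambda>t::real. 4 * cmod (of_real t * f \<sigma> v (of_real t))) \<longlongrightarrow> 4 * cmod 0) at_top"
    using lim' by (intro tendsto_intros) simp
  have "f \<sigma> v r = 0" if r: "Re r > 0" for r
  proof -
    have "Re r * cmod (f \<sigma> v r) \<le> 4 * cmod 0"
    proof (rule tendsto_lowerbound[OF lim0])
      show "\<forall>\<^sub>F t in at_top. Re r * cmod (f \<sigma> v r) \<le> 4 * cmod (complex_of_real t * f \<sigma> v (complex_of_real t))"
        using eventually_ge_at_top[of "cmod r"] eventually_gt_at_top[of 0]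
      proof eventually_elim
        case (elim t)
        have "t * (Re r * cmod (f \<sigma> v r)) \<le> (cmod (of_real t + cnj r))\<^sup>2 * cmod (f \<sigma> v (of_real t))"
          using f_Harnack[OF \<sigma>(1) r, of "of_real t" v] elim by (simp add: mult.assoc)
        also have "\<dots> \<le> (2 * t)\<^sup>2 * cmod (f \<sigma> v (of_real t))"
        proof (intro mult_right_mono power_mono)
          have "cmod (of_real t + cnj r) \<le> cmod (complex_of_real t) + cmod (cnj r)" by (rule norm_triangle_ineq)
          then show "cmod (of_real t + cnj r) \<le> 2 * t" using elim by simp
        qed auto
        also have "\<dots> = t * (4 * cmod (of_real t * f \<sigma> v (of_real t)))"
          using elim by (simp add: norm_mult power2_eq_square)
        finally show ?case using elim by simp
      qed
    qed simp
    then show ?thesis using r by (simp add: mult_le_0_iff)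
  qed
  then have "v = 0" by (rule f_nontrivial[OF \<sigma>(2)])
  then show False using v by simp
qed

lemma det_A_nz: "det A \<noteq> 0"
proof
  assume "det A = 0"
  then obtain v where "v \<noteq> 0" "A *v v = 0" unfolding det_zero_iff_kernel by blast
  then show False using A_positive[of v] by simp
qed

lemma regular_Fo:
  assumes "even n"
  shows "mp_regular Fo"
proof -
  obtain m where m: "n = 2 * m" using assms by (auto elim: evenE)
  show ?thesis
    by (rule mp_regular_leading_coeff[of "m - 1"]) (use coeffs_even[OF m] det_A_nz in auto)
qed

text \<open>The limit is minus the inverse of \<open>A\<close>, and the inverse of a positive
  definite matrix is positive definite.\<close>

lemma R_limit_negative:
  assumes "odd n"
  shows "\<exists>L. (R \<longlongrightarrow> L) at_infinity \<and> neg_definite L"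
proof (intro exI conjI)
  obtain m where m: "n = 2 * m + 1" using assms by (auto elim: oddE)
  show "(R \<longlongrightarrow> - (mat 1 ** matrix_inv A)) at_infinity"
    using rm_eval_assoc_rational_tendsto[of m Fe Fo] coeffs_odd[OF m] det_A_nz by simp
  define B where "B = matrix_inv A"
  have AB: "A *v (B *v x) = x" for x unfolding B_def by (rule det_nz_inv_vec(1)[OF det_A_nz])
  have symB: "cinner x (B *v y) = cinner (B *v x) y" for x y
    using A_symmetric[of "B *v x" "B *v y"] unfolding AB by simp
  have "ctranspose B = B"
    by (rule matrix_eqI_cinner) (simp add: cinner_ctranspose[of _ "ctranspose B"] symB)
  moreover have "Re (cinner x (B *v x)) > 0" if "x \<noteq> 0" for x
  proof -
    have "B *v x \<noteq> 0" using AB[of x] that by auto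
    then show ?thesis using A_positive[of "B *v x"] unfolding AB symB[of x] by simp
  qed
  ultimately have "neg_definite (- B)"
    unfolding neg_definite_def self_adjoint_matrix_def quad_form_cinner
    by (simp add: ctranspose_minus matrix_vec_minus cinner_minus)
  then show "neg_definite (- (mat 1 ** matrix_inv A))" unfolding B_def matrix_mul_lid .
qed

text \<open>A Jordan chain makes \<open>f 1 v\<close>, for \<open>v = F(s) x0\<close>, vanish to
  second order at the boundary point \<open>s\<close> with \<open>s\<^sup>2 = w\<close>. Harnack at
  \<open>s + e\<close> with \<open>e\<close> tending to 0 then gives \<open>f 1 v = 0\<close>
  everywhere, so \<open>v = 0\<close>.\<close>

lemma no_Jordan_chain:
  assumes w: "w \<in> mp_zeros Fe"
    and x0: "mp_eval Fe w *v x0 = 0"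
    and x1: "mp_eval Fe w *v x1 + mp_eval (map_matrix pderiv Fe) w *v x0 = 0"
  shows "x0 = 0"
proof -
  note wz = Fe_zeros[OF w]
  define s where "s = csqrt w"
  have s2: "s\<^sup>2 = w" by (simp add: s_def)
  have s: "Re s \<ge> 0" using csqrt_principal[of w] by (auto simp: s_def)
  define v where "v = mp_eval F s *v x0"
  have v_eq: "v = s *s (mp_eval Fo w *v x0)" unfolding v_def F_vec s2 x0 by simp
  \<comment> \<open>\<open>v\<close> is a multiple of \<open>Fo(w) x0\<close>; by symmetry at the
    real point \<open>w\<close> the product passes to \<open>Fe(w) x0 = 0\<close>.\<close>
  have vFe: "cinner v (mp_eval Fe w *v y) = 0" for y
    unfolding v_eq cinner_scale using Fe_Fo_symmetric[OF wz(1), of x0 y] x0 by simp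
  define d where "d = det F"
  obtain P where P: "\<And>z k. poly d z \<noteq> 0 \<Longrightarrow> X z v $ k = poly (P k) z / poly d z"
    unfolding d_def X_def using mp_inv_vec_rational[of F v] by blast
  have dz: "poly d z \<noteq> 0" if "Re z \<ge> 0" for z unfolding d_def by (rule det_F_nz[OF that])
  define a where "a = (\<lambda>k. \<Sum>i\<in>UNIV. smult (cnj (v $ i)) (Fe $ i $ k))"
  have a: "cinner v (mp_eval Fe z *v y) = (\<Sum>k\<in>UNIV. poly (a k) z * y $ k)" for z y
    by (simp add: a_def cinner_def matrix_vector_mult_def poly_sum sum_distrib_left sum_distrib_right mult.assoc)
      (rule sum.swap)
  have a': "cinner v (mp_eval (map_matrix pderiv Fe) z *v y) = (\<Sum>k\<in>UNIV. poly (pderiv (a k)) z * y $ k)" for z y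
    by (simp add: a_def cinner_def matrix_vector_mult_def pderiv_sum' pderiv_smult poly_sum sum_distrib_left sum_distrib_right mult.assoc)
      (rule sum.swap)
  have aw: "poly (a k) w = 0" for k
    using vFe[of "axis k 1"] unfolding a by (simp add: axis_def if_distrib cong: if_cong)
  \<comment> \<open>An explicit rational expression that agrees with \<open>f 1 v\<close> on the
    closed half-plane and is differentiable at \<open>s\<close>, even though \<open>s\<close> lies
    on the boundary.\<close>
  define G where "G = (\<lambda>z. 2 * (\<Sum>k\<in>UNIV. poly (a k) (z\<^sup>2) * (poly (P k) z / poly d z)))"
  have fG: "f 1 v z = G z" if "Re z \<ge> 0" for z
    unfolding f_def K_1 cinner_scale a G_def by (simp add: P dz that)
  have x0P: "poly (P k) s / poly d s = x0 $ k" for k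
    using P[OF dz[OF s], of k] unfolding v_def X_F[OF s] by simp
  have G0: "G s = 0" unfolding G_def s2 aw by simp
  have Dk: "((\<lambda>z. poly (a k) (z\<^sup>2) * (poly (P k) z / poly d z)) has_field_derivative
      poly (pderiv (a k)) w * (2 * s) * x0 $ k) (at s)" for k
  proof -
    have 1: "((\<lambda>z. poly (a k) (z\<^sup>2)) has_field_derivative poly (pderiv (a k)) (s\<^sup>2) * (2 * s)) (at s)"
      by (rule DERIV_chain2[OF poly_DERIV]) (auto intro!: derivative_eq_intros)
    have 2: "((\<lambda>z. poly (P k) z / poly d z) has_field_derivative
        (poly (pderiv (P k)) s * poly d s - poly (P k) s * poly (pderiv d) s) / (poly d s * poly d s)) (at s)"
      by (rule DERIV_divide[OF poly_DERIV poly_DERIV dz[OF s]])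
    show ?thesis using DERIV_mult[OF 1 2] unfolding s2 aw x0P by simp
  qed
  \<comment> \<open>The derivative of \<open>G\<close> at \<open>s\<close> is a multiple of this
    sum, the product of \<open>v\<close> with \<open>Fe'(w) x0\<close>. The chain replaces
    \<open>Fe'(w) x0\<close> by \<open>- Fe(w) x1\<close>, to which \<open>v\<close> is
    orthogonal.\<close>
  have "(\<Sum>k\<in>UNIV. poly (pderiv (a k)) w * x0 $ k) = cinner v (- (mp_eval Fe w *v x1))"
  proof -
    have "mp_eval (map_matrix pderiv Fe) w *v x0 = - (mp_eval Fe w *v x1)"
      using x1 by (simp add: eq_neg_iff_add_eq_0 add.commute)
    then show ?thesis unfolding a'[symmetric] by simp
  qed
  also have "\<dots> = 0" using vFe[of x1] by (simp add: cinner_minus)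
  finally have sum0: "(\<Sum>k\<in>UNIV. poly (pderiv (a k)) w * x0 $ k) = 0" .
  have "(\<Sum>k\<in>UNIV. poly (pderiv (a k)) w * (2 * s) * x0 $ k)
      = 2 * s * (\<Sum>k\<in>UNIV. poly (pderiv (a k)) w * x0 $ k)"
    by (simp add: sum_distrib_left mult_ac)
  then have D0: "2 * (\<Sum>k\<in>UNIV. poly (pderiv (a k)) w * (2 * s) * x0 $ k) = 0"
    using sum0 by simp
  have "(G has_field_derivative 2 * (\<Sum>k\<in>UNIV. poly (pderiv (a k)) w * (2 * s) * x0 $ k)) (at s)"
    unfolding G_def by (intro DERIV_cmult DERIV_sum Dk)
  then have "(G has_field_derivative 0) (at s)" unfolding D0 .
  then have Glim: "((\<lambda>h. G (s + h) / h) \<longlongrightarrow> 0) (at 0)"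
    unfolding DERIV_def G0 by simp
  have "filterlim complex_of_real (at 0) (at_right 0)"
    unfolding filterlim_at by (auto intro!: tendsto_eq_intros simp: eventually_at_filter)
  then have Glim: "((\<lambda>e::real. G (s + of_real e) / of_real e) \<longlongrightarrow> 0) (at_right 0)"
    by (rule filterlim_compose[OF Glim])
  have "f 1 v r = 0" if r: "Re r > 0" for r
  proof -
    have lim: "((\<lambda>e::real. (cmod (s + of_real e + cnj r))\<^sup>2 * cmod (G (s + of_real e) / of_real e))
        \<longlongrightarrow> (cmod (s + of_real 0 + cnj r))\<^sup>2 * cmod 0) (at_right 0)"
      by (intro tendsto_intros Glim)
    have "Re r * cmod (f 1 v r) \<le> (cmod (s + of_real 0 + cnj r))\<^sup>2 * cmod 0"
    proof (rule tendsto_lowerbound[OF lim])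
      show "\<forall>\<^sub>F e in at_right 0. Re r * cmod (f 1 v r)
          \<le> (cmod (s + of_real e + cnj r))\<^sup>2 * cmod (G (s + of_real e) / of_real e)"
        using eventually_at_right_less
      proof eventually_elim
        case (elim e)
        define z where "z = s + of_real e"
        have z: "Re z \<ge> e" "Re z > 0" using s elim by (simp_all add: z_def)
        have "e * (Re r * cmod (f 1 v r)) \<le> Re z * (Re r * cmod (f 1 v r))"
          using z r by (intro mult_right_mono) auto
        also have "\<dots> \<le> (cmod (z + cnj r))\<^sup>2 * cmod (f 1 v z)"
          using f_Harnack[of 1 r z v] r z by (simp add: mult.assoc)
        also have "f 1 v z = G z" using z by (intro fG) simp
        finally have "e * (Re r * cmod (f 1 v r)) \<le> (cmod (z + cnj r))\<^sup>2 * cmod (G z)" .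
        then show ?case unfolding z_def[symmetric] using elim
          by (simp add: norm_divide field_simps)
      qed
    qed simp
    then show ?thesis using r by (simp add: mult_le_0_iff)
  qed
  then have "v = 0" by (rule f_1_nontrivial)
  then show "x0 = 0" using F_vec_eq_0[OF s] by (simp add: v_def)
qed

lemma simple_Fe: "mp_simple Fe"
  unfolding mp_simple_def using regular_Fe order_det_eq_nullity no_Jordan_chain by blast

end

end

theorem theorem3p6:
  fixes F Fe Fo :: "complex poly ^ 'p::finite ^ 'p"
  assumes "mp_monic F"
    and "mp_degree F \<ge> 1"
    and "even_odd_parts F Fe Fo"
    and "odd (mp_degree F) \<Longrightarrow> mp_regular Fe"
    and "self_adjoint_rm (assoc_rational Fe Fo)"
  shows "(hurwitz_stable F \<longleftrightarrow>
            herglotz_nevanlinna (assoc_rational Fe Fo) \<and>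
            right_coprime Fe Fo \<and>
            (\<forall>z\<in>mp_zeros Fe. z \<in> \<real> \<and> Re z < 0) \<and>
            (even (mp_degree F) \<longrightarrow> mp_regular Fo) \<and>
            (odd (mp_degree F) \<longrightarrow>
               (\<exists>L. (rm_eval (assoc_rational Fe Fo) \<longlongrightarrow> L) at_infinity \<and> neg_definite L)))
         \<and> (hurwitz_stable F \<longrightarrow> mp_simple Fe)"
proof -
  \<comment> \<open>For even degree the leading coefficient of \<open>Fe\<close> is that of
    \<open>F\<close>, the identity.\<close>
  have regular: "mp_regular Fe"
  proof (cases "even (mp_degree F)")
    case True
    then obtain m where m: "mp_degree F = 2 * m" by (auto elim: evenE)
    show ?thesis
    proof (rule mp_regular_leading_coeff[of m])
      show "mp_coeff Fe k = 0" if "k > m" for k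
        using that m mp_coeff_eq_0[of F "2 * k"] by (simp add: even_odd_parts_coeff[OF assms(3)])
      show "det (mp_coeff Fe m) \<noteq> 0"
        using assms(1) m by (simp add: even_odd_parts_coeff[OF assms(3)] mp_monic_def)
    qed
  qed (rule assms(4))
  interpret self_adjoint_parts F Fe Fo
    using assms regular by unfold_locales auto
  have "hurwitz_stable F" if c: "herglotz_nevanlinna (assoc_rational Fe Fo)" "right_coprime Fe Fo"
    "\<forall>z\<in>mp_zeros Fe. z \<in> \<real> \<and> Re z < 0"
    "odd n \<longrightarrow> (\<exists>L. (R \<longlongrightarrow> L) at_infinity \<and> neg_definite L)"
  proof (cases "even n")
    case True
    then obtain m where m: "n = 2 * m" by (auto elim: evenE)
    \<comment> \<open>For even degree \<open>Fo\<close> has lower degree than the monic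
      \<open>Fe\<close>, so \<open>R\<close> tends to 0 and \<open>L = 0\<close> serves as the
      limit.\<close>
    have Fo0: "mp_coeff Fo k = 0" if "k \<ge> m" for k
      using coeffs_even(4)[OF m, of k] that deg m by simp
    have "(R \<longlongrightarrow> - (mp_coeff Fo m ** matrix_inv (mp_coeff Fe m))) at_infinity"
      using coeffs_even[OF m] Fo0 by (intro rm_eval_assoc_rational_tendsto) auto
    also have "- (mp_coeff Fo m ** matrix_inv (mp_coeff Fe m)) = 0"
      using Fo0[of m] by (simp add: vec_eq_iff matrix_matrix_mult_def)
    finally show ?thesis using c by (intro hurwitz_stable_if[of 0]) auto
  next
    case False
    then obtain L where L: "(R \<longlongrightarrow> L) at_infinity" "neg_definite L" using c(4) by blast
    have "Re (cinner y (L *v y)) \<le> 0" for y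
      using L(2) unfolding neg_definite_def quad_form_cinner by (cases "y = 0") (auto intro: less_imp_le)
    then show ?thesis using c L by (intro hurwitz_stable_if[of L]) auto
  qed
  moreover have "\<forall>z\<in>mp_zeros Fe. z \<in> \<real> \<and> Re z < 0" if "hurwitz_stable F"
    using Fe_zeros[OF that] by (simp add: complex_is_Real_iff)
  ultimately show ?thesis
    using herglotz_nevanlinna_R right_coprime_Fe_Fo regular_Fo R_limit_negative simple_Fe by (intro conjI iffI impI) simp_all
qed

end
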